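(* Let $I_0 \supset I_1 \supset \cdots \supset I_m = I$ be a descending chain of radical ideals in $\mathbb{R}[x_1,\ldots,x_n]$. For each $i$ let $X_i := \{x\in\mathbb{R}^n : g(x)=0 \text{ for all } g \in I_i\}$ and $X_i(\mathbb{C}) := \{x\in\mathbb{C}^n : g(x)=0 \text{ for all } g \in I_i\}$, and put $X := X_m$, $X(\mathbb{C}) := X_m(\mathbb{C})$. If the flag $X_0(\mathbb{C})\subset X_1(\mathbb{C})\subset\cdots\subset X_m(\mathbb{C})$ is a Whitney stratification of $X(\mathbb{C})$, then the flag $X_0\subset X_1\subset\cdots\subset X_m$ is a Whitney stratification of $X$.
   Context: Condition (B): a pair $(M,N)$ of smooth submanifolds of $\mathbb{R}^n$ satisfies Whitney's Condition (B) if for every $q\in N$ and all sequences $\{p_k\}\subset M$, $\{q_k\}\subset N$ with $\lim p_k = q=\lim q_k$, whenever the limiting tangent space $T=\lim T_{p_k}M$ and the limiting secant line $\ell=\lim [p_k,q_k]$ both exist, one has $\ell\subset T$. For submanifolds of $\mathbb{C}^n$ one uses $\mathbb{C}^n\cong\mathbb{R}^{2n}$. Whitney stratification: a Whitney stratification of a subset $X$ is a locally finite decomposition of $X$ into smooth connected nonempty manifolds (strata) such that every pair of strata satisfies Condition (B). Flags as stratifications: for a (real or complex) algebraic variety $X$, a flag of subvarieties $\varnothing = X_{-1}\subset X_0\subset X_1\subset\cdots\subset X_m=X$ is called a Whitney stratification of $X$ if each difference $X_i-X_{i-1}$ is either empty or a smooth manifold of dimension $i$ (real dimension in the real case, complex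 dimension in the complex case), and the connected components of the differences $X_i-X_{i-1}$ are the strata of a Whitney stratification of $X$. *)

theory Defs
  imports "HOL-Analysis.Analysis" "HOL-Library.Poly_Mapping"
begin

section \<open>Polynomials, ideals and varieties\<close>

text \<open>A monomial maps each variable to its exponent; a polynomial maps each monomial to its
  coefficient. The library's convolution product makes this type the commutative polynomial ring
  over \<open>'a\<close> in the variables \<open>'n\<close>.\<close>

type_synonym ('n, 'a) mpoly = "('n \<Rightarrow>\<^sub>0 nat) \<Rightarrow>\<^sub>0 'a"

definition mpoly_eval :: "('n::finite, 'a::comm_ring_1) mpoly \<Rightarrow> 'a ^ 'n \<Rightarrow> 'a" where
  "mpoly_eval p x =
     (\<Sum>\<alpha> \<in> Poly_Mapping.keys p. Poly_Mapping.lookup p \<alpha> * (\<Prod>i\<in>UNIV. (x $ i) ^ Poly_Mapping.lookup \<alpha> i))"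

definition complexify :: "('n, real) mpoly \<Rightarrow> ('n, complex) mpoly" where
  "complexify p = Poly_Mapping.map complex_of_real p"

definition zero_set :: "('n::finite, 'a::comm_ring_1) mpoly set \<Rightarrow> ('a ^ 'n) set" where
  "zero_set F = {x. \<forall>g\<in>F. mpoly_eval g x = 0}"

definition algebraic_set :: "('a::comm_ring_1 ^ 'n::finite) set \<Rightarrow> bool" where
  "algebraic_set A \<longleftrightarrow> (\<exists>F. A = zero_set F)"

definition is_ideal :: "'r::comm_ring_1 set \<Rightarrow> bool" where
  "is_ideal I \<longleftrightarrow> 0 \<in> I \<and> (\<forall>f\<in>I. \<forall>g\<in>I. f + g \<in> I) \<and> (\<forall>r. \<forall>f\<in>I. r * f \<in> I)"

text \<open>The unit ideal counts as radical, so that the empty variety is allowed.\<close>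

definition radical_ideal :: "'r::comm_ring_1 set \<Rightarrow> bool" where
  "radical_ideal I \<longleftrightarrow> is_ideal I \<and> (\<forall>f. \<forall>k\<ge>1. f ^ k \<in> I \<longrightarrow> f \<in> I)"

section \<open>Submanifolds\<close>

fun Ck_on :: "nat \<Rightarrow> 'a::real_normed_vector set \<Rightarrow> ('a \<Rightarrow> 'b::real_normed_vector) \<Rightarrow> bool" where
  "Ck_on 0 S f \<longleftrightarrow> continuous_on S f"
| "Ck_on (Suc k) S f \<longleftrightarrow>
     (\<forall>x\<in>S. f differentiable (at x)) \<and> (\<forall>v. Ck_on k S (\<lambda>x. frechet_derivative f (at x) v))"

text \<open>Only meant for open \<open>S\<close> and finite-dimensional domains, where continuity of all directional
  derivatives is continuity of the derivative.\<close>

definition smooth_on :: "'a::real_normed_vector set \<Rightarrow> ('a \<Rightarrow> 'b::real_normed_vector) \<Rightarrow> bool" where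
  "smooth_on S f \<longleftrightarrow> (\<forall>k. Ck_on k S f)"

definition smooth_submanifold :: "nat \<Rightarrow> 'a::euclidean_space set \<Rightarrow> bool" where
  "smooth_submanifold d M \<longleftrightarrow>
     (\<forall>p\<in>M. \<exists>U V \<phi> \<psi> W. open U \<and> p \<in> U \<and> open V \<and>
        homeomorphism U V \<phi> \<psi> \<and> smooth_on U \<phi> \<and> smooth_on V \<psi> \<and>
        subspace (W :: 'a set) \<and> dim W = d \<and> \<phi> ` (M \<inter> U) = V \<inter> W)"

text \<open>Holomorphy in several variables: the real Frechet derivative exists and is complex linear.\<close>

definition holomorphic_map_on :: "(complex ^ 'n::finite) set \<Rightarrow> (complex ^ 'n \<Rightarrow> complex ^ 'n) \<Rightarrow> bool" where
  "holomorphic_map_on S f \<longleftrightarrow>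
     (\<forall>x\<in>S. \<exists>D. (f has_derivative D) (at x) \<and> (\<forall>c v. D (c *s v) = c *s D v))"

definition complex_submanifold :: "nat \<Rightarrow> (complex ^ 'n::finite) set \<Rightarrow> bool" where
  "complex_submanifold d M \<longleftrightarrow>
     (\<forall>p\<in>M. \<exists>U V \<phi> \<psi> W. open U \<and> p \<in> U \<and> open V \<and>
        homeomorphism U V \<phi> \<psi> \<and> holomorphic_map_on U \<phi> \<and> holomorphic_map_on V \<psi> \<and>
        vec.subspace (W :: (complex ^ 'n) set) \<and> vec.dim W = d \<and> \<phi> ` (M \<inter> U) = V \<inter> W)"

definition tangent_space :: "'a::euclidean_space set \<Rightarrow> 'a \<Rightarrow> 'a set" where
  "tangent_space M p =
     {v. \<exists>\<gamma> e. e > 0 \<and> smooth_on {-e<..<e} \<gamma> \<and> \<gamma> ` {-e<..<e} \<subseteq> M \<and>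
           \<gamma> (0::real) = p \<and> (\<gamma> has_vector_derivative v) (at 0)}"

section \<open>Condition (B) and Whitney stratifications\<close>

text \<open>Convergence in the Grassmannian, whose topology is that of the orthogonal projectors; for a
  linear subspace \<open>V\<close> the orthogonal projector is \<open>closest_point V\<close>. In finite dimension pointwise
  convergence of the projectors is convergence in norm, and it forces the dimensions to agree
  eventually.\<close>

definition subspace_tendsto :: "(nat \<Rightarrow> 'a::euclidean_space set) \<Rightarrow> 'a set \<Rightarrow> bool" where
  "subspace_tendsto V T \<longleftrightarrow>
     subspace T \<and> (\<forall>x. (\<lambda>k. closest_point (V k) x) \<longlonglongrightarrow> closest_point T x)"

text \<open>The secant line through distinct points is taken as a direction, that is, translated to the
  origin. The spaces \<open>complex ^ 'n\<close> are covered through their underlying Euclidean structure.\<close>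

definition condition_B :: "'a::euclidean_space set \<Rightarrow> 'a set \<Rightarrow> bool" where
  "condition_B M N \<longleftrightarrow>
     (\<forall>y\<in>N. \<forall>p q T l.
        (\<forall>k. p k \<in> M) \<and> (\<forall>k. q k \<in> N) \<and> (\<forall>k. p k \<noteq> q k) \<and>
        p \<longlonglongrightarrow> y \<and> q \<longlonglongrightarrow> y \<and>
        subspace_tendsto (\<lambda>k. tangent_space M (p k)) T \<and>
        subspace_tendsto (\<lambda>k. span {p k - q k}) l
        \<longrightarrow> l \<subseteq> T)"

definition whitney_stratification :: "'a::euclidean_space set \<Rightarrow> 'a set set \<Rightarrow> bool" where
  "whitney_stratification X \<S> \<longleftrightarrow>
     \<Union>\<S> = X \<and> disjoint \<S> \<and>
     (\<forall>S\<in>\<S>. S \<noteq> {} \<and> connected S \<and> (\<exists>d. smooth_submanifold d S)) \<and>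
     (\<forall>x\<in>X. \<exists>U. open U \<and> x \<in> U \<and> finite {S\<in>\<S>. S \<inter> U \<noteq> {}}) \<and>
     (\<forall>M\<in>\<S>. \<forall>N\<in>\<S>. condition_B M N)"

section \<open>Flags\<close>

definition flag_diff :: "(nat \<Rightarrow> 'a set) \<Rightarrow> nat \<Rightarrow> 'a set" where
  "flag_diff X i = (case i of 0 \<Rightarrow> X 0 | Suc j \<Rightarrow> X (Suc j) - X j)"

definition flag_strata :: "nat \<Rightarrow> (nat \<Rightarrow> 'a::topological_space set) \<Rightarrow> 'a set set" where
  "flag_strata m X = (\<Union>i\<le>m. components (flag_diff X i))"

definition subvariety_flag :: "nat \<Rightarrow> (nat \<Rightarrow> ('a::comm_ring_1 ^ 'n::finite) set) \<Rightarrow> bool" where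
  "subvariety_flag m X \<longleftrightarrow> (\<forall>i\<le>m. algebraic_set (X i)) \<and> (\<forall>i<m. X i \<subseteq> X (Suc i))"

definition real_whitney_flag :: "nat \<Rightarrow> (nat \<Rightarrow> (real ^ 'n::finite) set) \<Rightarrow> bool" where
  "real_whitney_flag m X \<longleftrightarrow>
     subvariety_flag m X \<and>
     (\<forall>i\<le>m. flag_diff X i = {} \<or> smooth_submanifold i (flag_diff X i)) \<and>
     whitney_stratification (X m) (flag_strata m X)"

definition complex_whitney_flag :: "nat \<Rightarrow> (nat \<Rightarrow> (complex ^ 'n::finite) set) \<Rightarrow> bool" where
  "complex_whitney_flag m X \<longleftrightarrow>
     subvariety_flag m X \<and>
     (\<forall>i\<le>m. flag_diff X i = {} \<or> complex_submanifold i (flag_diff X i)) \<and>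
     whitney_stratification (X m) (flag_strata m X)"

end

theory Submission
  imports Defs "HOL-Complex_Analysis.Cauchy_Integral_Formula"
begin

text \<open>The complex strata are conjugation invariant. Near a real point such a manifold \<open>M\<close> has a holomorphic
  chart that commutes with conjugation, so its real points form a real submanifold whose real dimension is
  the complex dimension of \<open>M\<close>, and the tangent space of \<open>M\<close> is the complexification of the real tangent
  space. Orthogonal projectors are compatible with complexification, hence limits of tangent spaces and
  secants can be computed in the complex flag, and Condition (B) descends to the real strata.

  Local finiteness does not come from the complex flag: a difference of real algebraic sets has only
  finitely many connected components, which follows from an elementary form of Milnor's argument.\<close>

section \<open>Finitely many components of real algebraic sets\<close>

text \<open>Two mismatches between hypothesis and goal shape the proof. Condition (B) is given for
  connected components of the complex differences, while conjugation invariance is evident only for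
  the whole differences, whose equations have real coefficients. Tangent spaces do not change on
  passing to a component, so charts and tangent spaces are studied on whole differences, and
  components return when Condition (B) is applied. Moreover, \<open>complex_submanifold\<close>
  supplies charts with one complex linear derivative, whereas real strata must be smooth; Cauchy's
  formula makes every derivative complex differentiable again.

  A connected complex stratum may have many real components, so their finiteness needs its own
  argument. Milnor's count of critical points usually rests on nondegeneracy and Bezout's theorem.
  Here one critical point per piece of a partition suffices, so nondegeneracy never enters; the
  critical equations have leading terms \<open>(x \<bullet> b) ^ q\<close>, and linear algebra
  bounds any finite set of solutions by the number of monomials with all exponents below
  \<open>q\<close>.\<close>

inductive poly_deg_le :: "nat \<Rightarrow> ('a::euclidean_space \<Rightarrow> real) \<Rightarrow> bool" where
  const: "poly_deg_le d (\<lambda>x. c)"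
| coord: "poly_deg_le d f \<Longrightarrow> b \<in> Basis \<Longrightarrow> poly_deg_le (Suc d) (\<lambda>x. (x \<bullet> b) * f x)"
| add: "poly_deg_le d f \<Longrightarrow> poly_deg_le d g \<Longrightarrow> poly_deg_le d (\<lambda>x. f x + g x)"

lemma poly_deg_le_mono: "poly_deg_le d f \<Longrightarrow> d \<le> e \<Longrightarrow> poly_deg_le e f"
proof (induction arbitrary: e rule: poly_deg_le.induct)
  case (const d c)
  show ?case by (rule poly_deg_le.const)
next
  case (coord d f b)
  then obtain e' where "e = Suc e'" "d \<le> e'"
    by (metis Suc_le_D Suc_le_mono)
  with coord show ?case by (auto intro: poly_deg_le.coord)
next
  case (add d f g)
  then show ?case by (auto intro: poly_deg_le.add)
qed

lemma poly_deg_le_cmult: "poly_deg_le d f \<Longrightarrow> poly_deg_le d (\<lambda>x. c * f x)"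
proof (induction rule: poly_deg_le.induct)
  case (const d a)
  show ?case by (rule poly_deg_le.const)
next
  case (coord d f b)
  have "poly_deg_le (Suc d) (\<lambda>x. (x \<bullet> b) * (c * f x))"
    using coord by (intro poly_deg_le.coord)
  then show ?case by (simp add: mult.left_commute)
next
  case (add d f g)
  then show ?case by (auto simp: distrib_left intro: poly_deg_le.add)
qed

lemma poly_deg_le_sum:
  "finite S \<Longrightarrow> (\<And>i. i \<in> S \<Longrightarrow> poly_deg_le d (f i)) \<Longrightarrow> poly_deg_le d (\<lambda>x. \<Sum>i\<in>S. f i x)"
  by (induction S rule: finite_induct) (auto intro: poly_deg_le.intros)

lemma poly_deg_le_mult:
  "poly_deg_le d f \<Longrightarrow> poly_deg_le e g \<Longrightarrow> poly_deg_le (d + e) (\<lambda>x. f x * g x)"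
proof (induction rule: poly_deg_le.induct)
  case (const d c)
  then show ?case using poly_deg_le_cmult poly_deg_le_mono by (metis le_add2)
next
  case (coord d f b)
  then have "poly_deg_le (Suc (d + e)) (\<lambda>x. (x \<bullet> b) * (f x * g x))"
    by (auto intro: poly_deg_le.coord)
  then show ?case by (simp add: mult.assoc)
next
  case (add d f g)
  then show ?case by (auto simp: distrib_right intro: poly_deg_le.add)
qed

lemma poly_deg_le_coord_power: "b \<in> Basis \<Longrightarrow> poly_deg_le k (\<lambda>x. (x \<bullet> b) ^ k)"
  by (induction k) (auto intro: poly_deg_le.intros)

lemma poly_deg_le_monomial:
  "finite S \<Longrightarrow> S \<subseteq> Basis \<Longrightarrow> poly_deg_le (sum \<alpha> S) (\<lambda>x. \<Prod>b\<in>S. (x \<bullet> b) ^ \<alpha> b)"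
  by (induction S rule: finite_induct)
     (auto intro: poly_deg_le.const poly_deg_le_mult poly_deg_le_coord_power)

lemma real_polynomial_function_imp_poly_deg_le:
  fixes f :: "'a::euclidean_space \<Rightarrow> real"
  assumes "real_polynomial_function f"
  obtains d where "poly_deg_le d f"
proof -
  have "\<exists>d. poly_deg_le d f"
    using assms
  proof (induction rule: real_polynomial_function.induct)
    case (linear f)
    have "f = (\<lambda>x. \<Sum>b\<in>Basis. (x \<bullet> b) * f b)"
    proof
      fix x
      have "f x = f (\<Sum>b\<in>Basis. (x \<bullet> b) *\<^sub>R b)" by (simp add: euclidean_representation)
      also have "\<dots> = (\<Sum>b\<in>Basis. (x \<bullet> b) * f b)"
        using linear by (simp add: bounded_linear.linear linear_sum linear_cmul)
      finally show "f x = (\<Sum>b\<in>Basis. (x \<bullet> b) * f b)" .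
    qed
    moreover have "poly_deg_le (Suc 0) (\<lambda>x::'a. \<Sum>b\<in>Basis. (x \<bullet> b) * f b)"
      by (intro poly_deg_le_sum poly_deg_le.coord poly_deg_le.const) auto
    ultimately show ?case by metis
  next
    case (const c)
    then show ?case using poly_deg_le.const by blast
  next
    case (add f g)
    then obtain d e where "poly_deg_le d f" "poly_deg_le e g" by blast
    then have "poly_deg_le (max d e) f" "poly_deg_le (max d e) g"
      using poly_deg_le_mono by (metis max.cobounded1, metis max.cobounded2)
    then show ?case using poly_deg_le.add by blast
  next
    case (mult f g)
    then show ?case using poly_deg_le_mult by blast
  qed
  with that show ?thesis by blast
qed

text \<open>The partial derivatives come as functions \<open>g b\<close> with a degree bound because
  they become the right-hand sides of the critical equations. The bound \<open>d\<close> is not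
  lowered to \<open>d - 1\<close>; all that is asked later is \<open>d < q\<close>.\<close>

lemma poly_deg_le_derivative:
  fixes f :: "'a::euclidean_space \<Rightarrow> real"
  assumes "poly_deg_le d f"
  shows "\<exists>g. (\<forall>x. (f has_derivative (\<lambda>h. \<Sum>b\<in>Basis. (h \<bullet> b) * g b x)) (at x)) \<and>
             (\<forall>b\<in>Basis. poly_deg_le d (g b))"
  using assms
proof (induction rule: poly_deg_le.induct)
  case (const d c)
  show ?case by (intro exI[of _ "\<lambda>_ _. 0"]) (auto intro: poly_deg_le.const)
next
  case (coord d f b)
  then obtain g where g: "\<And>x. (f has_derivative (\<lambda>h. \<Sum>b\<in>Basis. (h \<bullet> b) * g b x)) (at x)"
    "\<And>b. b \<in> Basis \<Longrightarrow> poly_deg_le d (g b)" by blast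
  let ?g = "\<lambda>c x. (if c = b then f x else 0) + (x \<bullet> b) * g c x"
  have "((\<lambda>x. (x \<bullet> b) * f x) has_derivative (\<lambda>h. \<Sum>c\<in>Basis. (h \<bullet> c) * ?g c x)) (at x)" for x
  proof -
    have "((\<lambda>x. (x \<bullet> b) * f x) has_derivative
       (\<lambda>h. (x \<bullet> b) * (\<Sum>c\<in>Basis. (h \<bullet> c) * g c x) + (h \<bullet> b) * f x)) (at x)"
      by (rule has_derivative_mult) (auto intro!: derivative_eq_intros g)
    moreover have "(x \<bullet> b) * (\<Sum>c\<in>Basis. (h \<bullet> c) * g c x) + (h \<bullet> b) * f x
        = (\<Sum>c\<in>Basis. (h \<bullet> c) * ?g c x)" for h
    proof -
      have "(h \<bullet> b) * f x = (\<Sum>c\<in>Basis. if c = b then (h \<bullet> c) * f x else 0)"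
        using coord.hyps by (simp add: sum.delta)
      moreover have "(\<Sum>c\<in>Basis. (h \<bullet> c) * ?g c x) = (\<Sum>c\<in>Basis. if c = b then (h \<bullet> c) * f x else 0)
          + (\<Sum>c\<in>Basis. (x \<bullet> b) * ((h \<bullet> c) * g c x))"
        unfolding sum.distrib[symmetric] by (rule sum.cong) (auto simp: distrib_left)
      ultimately show ?thesis by (simp add: sum_distrib_left)
    qed
    ultimately show ?thesis by simp
  qed
  moreover have "poly_deg_le (Suc d) (?g c)" if "c \<in> Basis" for c
  proof (rule poly_deg_le.add)
    show "poly_deg_le (Suc d) (\<lambda>x. if c = b then f x else 0)"
      using coord.hyps(1) poly_deg_le_mono[of d f "Suc d"] by (cases "c = b") (auto intro: poly_deg_le.const)
    show "poly_deg_le (Suc d) (\<lambda>x. (x \<bullet> b) * g c x)"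
      using coord.hyps that g by (intro poly_deg_le.coord) auto
  qed
  ultimately show ?case by (intro exI[of _ ?g]) blast
next
  case (add d f g)
  then obtain f' g' where
    "\<And>x. (f has_derivative (\<lambda>h. \<Sum>b\<in>Basis. (h \<bullet> b) * f' b x)) (at x)"
    "\<And>x. (g has_derivative (\<lambda>h. \<Sum>b\<in>Basis. (h \<bullet> b) * g' b x)) (at x)"
    "\<forall>b\<in>Basis. poly_deg_le d (f' b)" "\<forall>b\<in>Basis. poly_deg_le d (g' b)"
    by blast
  then show ?case
    by (intro exI[of _ "\<lambda>b x. f' b x + g' b x"])
       (auto simp: distrib_left sum.distrib intro!: derivative_intros poly_deg_le.add)
qed

section \<open>Normal forms modulo relations for the powers
  \<open>(x \<bullet> b) ^ q\<close>\<close>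

text \<open>\<open>PiE\<close> fixes the values outside \<open>Basis\<close>, which makes the set
  finite. Its cardinality, \<open>q\<close> to the power of the dimension, plays the part of
  Bezout's number.\<close>

definition reduced_monomials :: "nat \<Rightarrow> ('a::euclidean_space \<Rightarrow> nat) set" where
  "reduced_monomials q = PiE Basis (\<lambda>_. {..<q})"

lemma finite_reduced_monomials: "finite (reduced_monomials q)"
  by (simp add: reduced_monomials_def finite_PiE)

definition monomial :: "('a::euclidean_space \<Rightarrow> nat) \<Rightarrow> 'a \<Rightarrow> real" where
  "monomial \<alpha> x = (\<Prod>b\<in>Basis. (x \<bullet> b) ^ \<alpha> b)"

text \<open>Equality is demanded only at points of \<open>Z\<close>, with coefficients independent
  of the point. Keeping the degree bound \<open>e\<close> lets a reduced form be fed back into the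
  induction on the degree.\<close>

definition reduces_on :: "nat \<Rightarrow> 'a::euclidean_space set \<Rightarrow> nat \<Rightarrow> ('a \<Rightarrow> real) \<Rightarrow> bool" where
  "reduces_on q Z e f \<longleftrightarrow> (\<exists>c. \<forall>x\<in>Z. f x =
     (\<Sum>\<alpha>\<in>{\<alpha>\<in>reduced_monomials q. sum \<alpha> Basis \<le> e}. c \<alpha> * monomial \<alpha> x))"

lemma reduces_on_cong: "reduces_on q Z e f \<Longrightarrow> (\<And>x. x \<in> Z \<Longrightarrow> f x = g x) \<Longrightarrow> reduces_on q Z e g"
  unfolding reduces_on_def by auto

lemma reduces_on_add:
  assumes "reduces_on q Z e f" "reduces_on q Z e g"
  shows "reduces_on q Z e (\<lambda>x. f x + g x)"
proof -
  obtain c d where "\<forall>x\<in>Z. f x = (\<Sum>\<alpha>\<in>{\<alpha>\<in>reduced_monomials q. sum \<alpha> Basis \<le> e}. c \<alpha> * monomial \<alpha> x)"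
   "\<forall>x\<in>Z. g x = (\<Sum>\<alpha>\<in>{\<alpha>\<in>reduced_monomials q. sum \<alpha> Basis \<le> e}. d \<alpha> * monomial \<alpha> x)"
    using assms unfolding reduces_on_def by blast
  then show ?thesis unfolding reduces_on_def
    by (intro exI[of _ "\<lambda>\<alpha>. c \<alpha> + d \<alpha>"]) (auto simp: distrib_right sum.distrib)
qed

lemma reduces_on_cmult:
  assumes "reduces_on q Z e f"
  shows "reduces_on q Z e (\<lambda>x. a * f x)"
proof -
  obtain c where "\<forall>x\<in>Z. f x = (\<Sum>\<alpha>\<in>{\<alpha>\<in>reduced_monomials q. sum \<alpha> Basis \<le> e}. c \<alpha> * monomial \<alpha> x)"
    using assms unfolding reduces_on_def by blast
  then show ?thesis unfolding reduces_on_def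
    by (intro exI[of _ "\<lambda>\<alpha>. a * c \<alpha>"]) (auto simp: sum_distrib_left mult.assoc)
qed

lemma reduces_on_monomial:
  assumes "\<alpha> \<in> reduced_monomials q" "sum \<alpha> Basis \<le> e"
  shows "reduces_on q Z e (monomial \<alpha>)"
  unfolding reduces_on_def
proof (intro exI ballI)
  fix x
  let ?A = "{\<alpha>\<in>reduced_monomials q. sum \<alpha> Basis \<le> e}"
  have "(\<Sum>\<beta>\<in>?A. (if \<beta> = \<alpha> then 1 else 0) * monomial \<beta> x)
    = (\<Sum>\<beta>\<in>?A. if \<beta> = \<alpha> then monomial \<alpha> x else 0)"
    by (rule sum.cong) auto
  also have "\<dots> = monomial \<alpha> x"
    using assms finite_reduced_monomials[of q] by (subst sum.delta) auto
  finally show "monomial \<alpha> x = (\<Sum>\<beta>\<in>?A. (if \<beta> = \<alpha> then 1 else 0) * monomial \<beta> x)" ..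
qed

lemma reduces_on_mono:
  assumes "reduces_on q Z e f" "e \<le> e'"
  shows "reduces_on q Z e' f"
proof -
  obtain c where c: "\<forall>x\<in>Z. f x = (\<Sum>\<alpha>\<in>{\<alpha>\<in>reduced_monomials q. sum \<alpha> Basis \<le> e}. c \<alpha> * monomial \<alpha> x)"
    using assms unfolding reduces_on_def by blast
  have "(\<Sum>\<alpha>\<in>{\<alpha>\<in>reduced_monomials q. sum \<alpha> Basis \<le> e}. c \<alpha> * monomial \<alpha> x)
    = (\<Sum>\<alpha>\<in>{\<alpha>\<in>reduced_monomials q. sum \<alpha> Basis \<le> e'}.
         (if sum \<alpha> Basis \<le> e then c \<alpha> else 0) * monomial \<alpha> x)" for x
    using assms(2) finite_reduced_monomials[of q] by (intro sum.mono_neutral_cong_left) auto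
  with c show ?thesis unfolding reduces_on_def
    by (intro exI[of _ "\<lambda>\<alpha>. if sum \<alpha> Basis \<le> e then c \<alpha> else 0"]) auto
qed

lemma reduces_on_sum:
  assumes "finite S" "\<And>i. i \<in> S \<Longrightarrow> reduces_on q Z e (f i)"
  shows "reduces_on q Z e (\<lambda>x. \<Sum>i\<in>S. f i x)"
  using assms
proof (induction S rule: finite_induct)
  case empty
  then show ?case unfolding reduces_on_def by (intro exI[of _ "\<lambda>_. 0"]) auto
next
  case (insert i S)
  then show ?case by (auto intro: reduces_on_add)
qed

text \<open>Multiplying a reduced monomial by a coordinate leaves the reduced monomials only when an
  exponent reaches \<open>q\<close>; there the relation on \<open>Z\<close> lowers the total degree.\<close>

lemma poly_deg_le_reduces_on:
  fixes Z :: "'a::euclidean_space set"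
  assumes rel: "\<And>b x. b \<in> Basis \<Longrightarrow> x \<in> Z \<Longrightarrow> (x \<bullet> b) ^ q = g b x"
    and g: "\<And>b. b \<in> Basis \<Longrightarrow> poly_deg_le d (g b)" and "d < q"
    and "poly_deg_le e f"
  shows "reduces_on q Z e f"
  using \<open>poly_deg_le e f\<close>
proof (induction e arbitrary: f rule: less_induct)
  case (less e)
  have step: "reduces_on q Z e (\<lambda>x. (x \<bullet> b) * monomial \<alpha> x)"
    if "\<alpha> \<in> reduced_monomials q" "Suc (sum \<alpha> Basis) \<le> e" and b: "b \<in> Basis" for \<alpha> :: "'a \<Rightarrow> nat" and b
  proof (cases "Suc (\<alpha> b) < q")
    case True
    let ?\<beta> = "\<alpha>(b := Suc (\<alpha> b))"
    have "(\<Prod>c\<in>Basis. (x \<bullet> c) ^ ?\<beta> c) = (x \<bullet> b) * (\<Prod>c\<in>Basis. (x \<bullet> c) ^ \<alpha> c)" for x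
    proof -
      have "(\<Prod>c\<in>Basis-{b}. (x \<bullet> c) ^ ?\<beta> c) = (\<Prod>c\<in>Basis-{b}. (x \<bullet> c) ^ \<alpha> c)"
        by (rule prod.cong) auto
      then show ?thesis
        using b by (simp add: prod.remove[of Basis b] mult.assoc)
    qed
    then have "(\<lambda>x. (x \<bullet> b) * monomial \<alpha> x) = monomial ?\<beta>"
      by (auto simp: monomial_def)
    moreover have "sum ?\<beta> Basis = Suc (sum \<alpha> Basis)"
    proof -
      have "sum ?\<beta> (Basis - {b}) = sum \<alpha> (Basis - {b})"
        by (rule sum.cong) auto
      then show ?thesis using b by (simp add: sum.remove[of Basis b])
    qed
    moreover have "?\<beta> \<in> reduced_monomials q"
      using that True by (auto simp: reduced_monomials_def PiE_iff extensional_def)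
    ultimately show ?thesis
      using that reduces_on_monomial by (metis (no_types, lifting))
  next
    case False
    then have q: "q = Suc (\<alpha> b)"
      using that by (simp add: reduced_monomials_def PiE_iff) (meson Suc_leI b le_antisym linorder_not_less)
    let ?h = "\<lambda>x. g b x * (\<Prod>c\<in>Basis - {b}. (x \<bullet> c) ^ \<alpha> c)"
    have deg: "poly_deg_le (d + sum \<alpha> (Basis - {b})) ?h"
      by (intro poly_deg_le_mult g b poly_deg_le_monomial) auto
    have "d + sum \<alpha> (Basis - {b}) \<le> sum \<alpha> Basis"
      using \<open>d < q\<close> q b by (simp add: sum.remove[of Basis b])
    then have "d + sum \<alpha> (Basis - {b}) < e" using that by simp
    then have "reduces_on q Z e ?h"
      using less.IH[OF _ deg] by (auto intro: reduces_on_mono[OF _ less_imp_le])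
    moreover have "?h x = (x \<bullet> b) * monomial \<alpha> x" if "x \<in> Z" for x
    proof -
      have "monomial \<alpha> x = (x \<bullet> b) ^ \<alpha> b * (\<Prod>c\<in>Basis - {b}. (x \<bullet> c) ^ \<alpha> c)"
        unfolding monomial_def using b by (simp add: prod.remove)
      moreover have "g b x = (x \<bullet> b) * (x \<bullet> b) ^ \<alpha> b"
        using rel[OF b that] q by simp
      ultimately show ?thesis by simp
    qed
    ultimately show ?thesis by (rule reduces_on_cong)
  qed
  \<comment> \<open>The outer strong induction serves strictly smaller degrees. The structural
    induction is needed because \<open>add\<close> keeps the degree bound; \<open>k = e\<close>
    frees the index for it.\<close>
  have "reduces_on q Z e f" if "poly_deg_le k f" "k = e" for k f
    using that
  proof (induction rule: poly_deg_le.induct)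
    case (const k c)
    let ?o = "restrict (\<lambda>_. 0) Basis :: 'a \<Rightarrow> nat"
    have "reduces_on q Z e (monomial ?o)"
      using \<open>d < q\<close> by (intro reduces_on_monomial) (auto simp: reduced_monomials_def)
    moreover have "monomial ?o = (\<lambda>_. 1)" by (auto simp: monomial_def)
    ultimately show ?case using reduces_on_cmult[of q Z e "\<lambda>_. 1" c] by simp
  next
    case (coord d' f b)
    then have "reduces_on q Z d' f" using less.IH by blast
    then obtain c where c: "\<forall>x\<in>Z. f x = (\<Sum>\<alpha>\<in>{\<alpha>\<in>reduced_monomials q. sum \<alpha> Basis \<le> d'}. c \<alpha> * monomial \<alpha> x)"
      unfolding reduces_on_def by blast
    have "reduces_on q Z e (\<lambda>x. \<Sum>\<alpha>\<in>{\<alpha>\<in>reduced_monomials q. sum \<alpha> Basis \<le> d'}. c \<alpha> * ((x \<bullet> b) * monomial \<alpha> x))"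
      using coord by (intro reduces_on_sum reduces_on_cmult step) (auto simp: finite_reduced_monomials)
    then show ?case
      by (rule reduces_on_cong) (use c in \<open>auto simp: sum_distrib_left mult.left_commute\<close>)
  next
    case (add k f g)
    then show ?case by (auto intro: reduces_on_add)
  qed
  then show ?case using less.prems by blast
qed

section \<open>Counting common zeros by linear algebra\<close>

text \<open>Gaussian elimination by induction on the set of equations: a nonzero coefficient of
  equation \<open>l\<close> serves as pivot, \<open>?B\<close> is the system after elimination of
  the unknown \<open>k\<close>, and \<open>c k\<close> is then chosen to satisfy equation
  \<open>l\<close>.\<close>

lemma homogeneous_system_nontrivial:
  fixes A :: "'i \<Rightarrow> 'j \<Rightarrow> real"
  assumes "finite L" "finite J" "card L < card J"
  shows "\<exists>c. (\<exists>j\<in>J. c j \<noteq> 0) \<and> (\<forall>l\<in>L. (\<Sum>j\<in>J. c j * A l j) = 0)"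
  using assms
proof (induction L arbitrary: A J rule: finite_induct)
  case empty
  then show ?case by (intro exI[of _ "\<lambda>_. 1"]) (auto simp: card_gt_0_iff)
next
  case (insert l L)
  show ?case
  proof (cases "\<forall>j\<in>J. A l j = 0")
    case True
    have "card L < card J" using insert by simp
    then obtain c where "\<exists>j\<in>J. c j \<noteq> 0" "\<forall>l\<in>L. (\<Sum>j\<in>J. c j * A l j) = 0"
      using insert by blast
    with True show ?thesis by (intro exI[of _ c]) auto
  next
    case False
    then obtain k where k: "k \<in> J" "A l k \<noteq> 0" by blast
    let ?B = "\<lambda>i j. A i j - A l j / A l k * A i k"
    have "card L < card (J - {k})" using insert k by simp
    then obtain c where c: "\<exists>j\<in>J - {k}. c j \<noteq> 0" "\<forall>i\<in>L. (\<Sum>j\<in>J - {k}. c j * ?B i j) = 0"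
      using insert.IH[of "J - {k}" ?B] insert.prems by auto
    let ?s = "\<Sum>j\<in>J - {k}. c j * A l j"
    let ?c = "c(k := - ?s / A l k)"
    have *: "(\<Sum>j\<in>J. ?c j * A i j) = - ?s / A l k * A i k + (\<Sum>j\<in>J - {k}. c j * A i j)" for i
    proof -
      have "(\<Sum>j\<in>J - {k}. ?c j * A i j) = (\<Sum>j\<in>J - {k}. c j * A i j)"
        by (rule sum.cong) auto
      then show ?thesis using insert.prems k by (simp add: sum.remove[of J k])
    qed
    have "(\<Sum>j\<in>J. ?c j * A i j) = 0" if "i \<in> L" for i
    proof -
      have "0 = (\<Sum>j\<in>J - {k}. c j * A i j) - (\<Sum>j\<in>J - {k}. c j * (A l j / A l k * A i k))"
        using c(2) that by (simp add: right_diff_distrib sum_subtractf)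
      also have "(\<Sum>j\<in>J - {k}. c j * (A l j / A l k * A i k)) = ?s / A l k * A i k"
        by (simp add: sum_distrib_right sum_divide_distrib mult.assoc)
      finally show ?thesis using * by simp
    qed
    moreover have "(\<Sum>j\<in>J. ?c j * A l j) = 0" using * k by simp
    moreover have "\<exists>j\<in>J. ?c j \<noteq> 0" using c(1) by auto
    ultimately show ?thesis by (intro exI[of _ ?c]) auto
  qed
qed

text \<open>With more points than reduced monomials, some nonzero weights \<open>c\<close> on
  \<open>Z\<close> annihilate all reduced monomials, hence all polynomials by reduction. A
  polynomial that vanishes at all points of \<open>Z\<close> but one, where the weight is nonzero,
  contradicts this.\<close>

lemma card_common_zeros_le:
  fixes Z :: "'a::euclidean_space set"
  assumes rel: "\<And>b x. b \<in> Basis \<Longrightarrow> x \<in> Z \<Longrightarrow> (x \<bullet> b) ^ q = g b x"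
    and g: "\<And>b. b \<in> Basis \<Longrightarrow> poly_deg_le d (g b)" and "d < q"
    and "finite Z"
  shows "card Z \<le> card (reduced_monomials q :: ('a \<Rightarrow> nat) set)"
proof (rule ccontr)
  assume "\<not> ?thesis"
  then obtain c where c: "\<exists>z\<in>Z. c z \<noteq> 0"
    "\<And>\<alpha>. \<alpha> \<in> reduced_monomials q \<Longrightarrow> (\<Sum>z\<in>Z. c z * monomial \<alpha> z) = 0"
    using homogeneous_system_nontrivial[OF finite_reduced_monomials \<open>finite Z\<close>,
        of q monomial] by auto
  have vanish: "(\<Sum>z\<in>Z. c z * f z) = 0" if f: "poly_deg_le e f" for e f
  proof -
    have "reduces_on q Z e f"
      using poly_deg_le_reduces_on[where Z=Z and g=g and q=q, OF rel g \<open>d < q\<close> f] by blast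
    then obtain a where a: "\<forall>x\<in>Z. f x =
      (\<Sum>\<alpha>\<in>{\<alpha>\<in>reduced_monomials q. sum \<alpha> Basis \<le> e}. a \<alpha> * monomial \<alpha> x)"
      unfolding reduces_on_def by blast
    then have "(\<Sum>z\<in>Z. c z * f z) = (\<Sum>z\<in>Z. \<Sum>\<alpha>\<in>{\<alpha>\<in>reduced_monomials q. sum \<alpha> Basis \<le> e}.
        a \<alpha> * (c z * monomial \<alpha> z))"
      by (intro sum.cong) (auto simp: sum_distrib_left mult_ac)
    also have "\<dots> = (\<Sum>\<alpha>\<in>{\<alpha>\<in>reduced_monomials q. sum \<alpha> Basis \<le> e}.
        a \<alpha> * (\<Sum>z\<in>Z. c z * monomial \<alpha> z))"
      by (subst sum.swap) (simp add: sum_distrib_left)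
    also have "\<dots> = 0" using c(2) by simp
    finally show ?thesis .
  qed
  obtain w where w: "w \<in> Z" "c w \<noteq> 0" using c(1) by blast
  \<comment> \<open>Lagrange-type polynomial for the point \<open>w\<close>: it vanishes at the
    other points, and at \<open>w\<close> each factor is a nonzero squared distance.\<close>
  let ?f = "\<lambda>x. \<Prod>z\<in>Z - {w}. (x - z) \<bullet> (w - z)"
  have "real_polynomial_function ?f"
    using \<open>finite Z\<close>
  proof (intro real_polynomial_function_prod)
    fix z assume "z \<in> Z - {w}"
    have "real_polynomial_function (\<lambda>x. x \<bullet> (w - z) - z \<bullet> (w - z))"
      by (intro real_polynomial_function_diff real_polynomial_function.intros(1,2)
          bounded_linear_inner_left)
    then show "real_polynomial_function (\<lambda>x. (x - z) \<bullet> (w - z))"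
      by (simp add: inner_diff_left)
  qed simp
  then obtain e where "poly_deg_le e ?f" by (rule real_polynomial_function_imp_poly_deg_le)
  then have "(\<Sum>z\<in>Z. c z * ?f z) = 0" by (rule vanish)
  moreover have "(\<Sum>z\<in>Z. c z * ?f z) = c w * ?f w"
  proof -
    have "?f z = 0" if "z \<in> Z - {w}" for z
      using that \<open>finite Z\<close> by (intro prod_zero bexI[of _ z]) auto
    then have "(\<Sum>z\<in>Z - {w}. c z * ?f z) = 0" by (intro sum.neutral) simp
    then show ?thesis
      using w \<open>finite Z\<close> by (simp only: sum.remove[of Z w])
  qed
  moreover have "?f w \<noteq> 0" using \<open>finite Z\<close> by (auto simp: prod_zero_iff)
  ultimately show False using w by simp
qed

section \<open>Clopen partitions and the perturbation argument\<close>

text \<open>Finitely many pieces cannot all be connected: a piece is also open, its complement in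
  \<open>V\<close> being a finite union of closed pieces, so connected pieces would include all
  components. A disconnected piece is split, which raises the count by one.\<close>

lemma infinite_components_clopen_partition:
  fixes V :: "'a::topological_space set"
  assumes "infinite (components V)"
  shows "\<exists>P. finite P \<and> card P = Suc k \<and> disjoint P \<and> \<Union>P = V \<and>
     (\<forall>A\<in>P. A \<noteq> {} \<and> closedin (top_of_set V) A)"
proof (induction k)
  case 0
  have "V \<noteq> {}" using assms by auto
  then show ?case by (intro exI[of _ "{V}"]) auto
next
  case (Suc k)
  then obtain P where P: "finite P" "card P = Suc k" "disjoint P" "\<Union>P = V"
    "\<And>A. A \<in> P \<Longrightarrow> A \<noteq> {}" "\<And>A. A \<in> P \<Longrightarrow> closedin (top_of_set V) A" by metis
  have "\<exists>A\<in>P. \<not> connected A"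
  proof (rule ccontr)
    assume "\<not> ?thesis"
    then have conn: "\<And>A. A \<in> P \<Longrightarrow> connected A" by blast
    have "components V \<subseteq> P"
    proof
      fix C assume C: "C \<in> components V"
      then obtain x where "x \<in> C" "C \<subseteq> V"
        using in_components_nonempty in_components_subset by blast
      then obtain A where A: "A \<in> P" "x \<in> A" using P by blast
      have "A \<subseteq> C"
        using components_maximal[OF C conn[OF A(1)]] A P \<open>x \<in> C\<close> by blast
      moreover have "C \<subseteq> A"
      proof -
        have "V - A = \<Union>(P - {A})"
          using P(3,4) A(1) by (auto simp: disjoint_def)
        moreover have "closedin (top_of_set V) (\<Union>(P - {A}))"
          using P by (intro closedin_Union) auto
        ultimately have "openin (top_of_set V) A"
          by (metis A(1) P(4) Sup_upper closedin_def double_diff openin_topspace order_refl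
              topspace_euclidean_subtopology)
        then have "openin (top_of_set C) (C \<inter> A)" "closedin (top_of_set C) (C \<inter> A)"
          using \<open>C \<subseteq> V\<close> P(6)[OF A(1)]
          by (auto simp: openin_open closedin_closed)
        moreover have "connected C" using C by (rule in_components_connected)
        ultimately have "C \<inter> A = {} \<or> C \<inter> A = C"
          by (simp add: connected_clopen)
        then show ?thesis using \<open>x \<in> C\<close> A by blast
      qed
      ultimately show "C \<in> P" using A by auto
    qed
    then show False using assms P(1) finite_subset by blast
  qed
  then obtain A where A: "A \<in> P" "\<not> connected A" by blast
  then obtain B C where BC: "closedin (top_of_set A) B" "closedin (top_of_set A) C"
    "B \<union> C = A" "B \<inter> C = {}" "B \<noteq> {}" "C \<noteq> {}"
    by (auto simp: connected_closedin_eq)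
  let ?P = "insert B (insert C (P - {A}))"
  have "B \<notin> P - {A}" "C \<notin> P - {A}"
    using disjointD[OF P(3) _ A(1), of B] disjointD[OF P(3) _ A(1), of C] BC by blast+
  moreover have "B \<noteq> C" using BC by blast
  ultimately have ne: "B \<notin> P - {A}" "C \<notin> P - {A}" "B \<noteq> C" by blast+
  have "card ?P = Suc (Suc k)"
    using ne P A by simp
  moreover have "disjoint ?P"
  proof -
    have "D \<inter> B = {}" "D \<inter> C = {}" if "D \<in> P - {A}" for D
      using disjointD[OF P(3), of D A] that A BC by blast+
    moreover have "disjoint (P - {A})"
      using P(3) by (rule pairwise_subset) blast
    ultimately show ?thesis
      using BC(4) by (auto simp: pairwise_insert disjnt_def Int_commute)
  qed
  moreover have "\<Union>?P = V" using P(4) A BC by auto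
  moreover have "closedin (top_of_set V) B" "closedin (top_of_set V) C"
    using BC P(6)[OF A(1)] closedin_trans by blast+
  ultimately show ?case
    using P BC by (intro exI[of _ ?P]) auto
qed

text \<open>\<open>N A\<close> consists of the points strictly nearer to \<open>A\<close> than to
  every other piece. Nonempty pieces are required because \<open>infdist\<close> to the empty set is
  zero.\<close>

lemma disjoint_closed_family_separation:
  fixes P :: "'a::metric_space set set"
  assumes "finite P" "disjoint P" "\<And>A. A \<in> P \<Longrightarrow> closed A" "\<And>A. A \<in> P \<Longrightarrow> A \<noteq> {}"
  obtains N where "\<And>A. A \<in> P \<Longrightarrow> open (N A)" "\<And>A. A \<in> P \<Longrightarrow> A \<subseteq> N A"
    "\<And>A B. A \<in> P \<Longrightarrow> B \<in> P \<Longrightarrow> A \<noteq> B \<Longrightarrow> N A \<inter> N B = {}"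
proof
  let ?N = "\<lambda>A. \<Inter>B\<in>P - {A}. {x. infdist x A < infdist x B}"
  show "open (?N A)" if "A \<in> P" for A
    using assms(1) by (intro open_INT ballI open_Collect_less continuous_intros) auto
  show "A \<subseteq> ?N A" if "A \<in> P" for A
  proof (intro subsetI INT_I CollectI)
    fix x B assume "x \<in> A" "B \<in> P - {A}"
    then have "B \<in> P \<and> B \<noteq> A" by blast
    then have "x \<notin> B" using disjointD[OF assms(2) that, of B] \<open>x \<in> A\<close> by blast
    then have "infdist x B > 0"
      using assms(3,4) \<open>B \<in> P \<and> B \<noteq> A\<close>
      by (metis infdist_nonneg in_closed_iff_infdist_zero less_eq_real_def)
    then show "infdist x A < infdist x B" using \<open>x \<in> A\<close> by simp
  qed
  show "?N A \<inter> ?N B = {}" if "A \<in> P" "B \<in> P" "A \<noteq> B" for A B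
  proof (rule ccontr)
    assume "?N A \<inter> ?N B \<noteq> {}"
    then obtain x where "x \<in> ?N A" "x \<in> ?N B" by blast
    then have "infdist x A < infdist x B" "infdist x B < infdist x A" using that by auto
    then show False by simp
  qed
qed

text \<open>The components of \<open>{G = 0}\<close> leave no trace in the critical points of \<open>G\<close>, so \<open>G\<close> is perturbed to
  \<open>H = G - \<epsilon> (\<rho> - \<Sum>b. (x \<bullet> b) ^ (q + 1))\<close> for an odd \<open>q\<close> exceeding the degree of \<open>G\<close>; \<open>H\<close> attains a
  negative minimum near each piece of a clopen partition. Its critical equations express each
  \<open>(x \<bullet> b) ^ q\<close> by a polynomial of degree less than \<open>q\<close>.\<close>

lemma finite_components_zeros_nonneg:
  fixes G :: "'a::euclidean_space \<Rightarrow> real"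
  assumes G: "real_polynomial_function G" and nonneg: "\<And>x. G x \<ge> 0"
  shows "finite (components {x. G x = 0})"
proof (rule ccontr)
  let ?V = "{x. G x = 0}"
  assume "infinite (components ?V)"
  obtain d where d: "poly_deg_le d G"
    using G by (rule real_polynomial_function_imp_poly_deg_le)
  obtain g where g: "\<And>x. (G has_derivative (\<lambda>h. \<Sum>b\<in>Basis. (h \<bullet> b) * g b x)) (at x)"
    "\<And>b. b \<in> Basis \<Longrightarrow> poly_deg_le d (g b)"
    using poly_deg_le_derivative[OF d] by blast
  have contG: "continuous_on UNIV G"
    by (intro continuous_at_imp_continuous_on ballI has_derivative_continuous[OF g(1)])
  have clV: "closed ?V"
    using contG by (intro closed_Collect_eq continuous_intros)
  \<comment> \<open>An odd \<open>q\<close> gives \<open>S\<close> an even exponent, hence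
    nonnegative values and bounded sublevel sets; \<open>q > d\<close> is the condition under which
    the solutions can be counted.\<close>
  define q where "q = Suc (2 * d)"
  define K where "K = card (reduced_monomials q :: ('a \<Rightarrow> nat) set)"
  obtain P where P: "finite P" "card P = Suc K" "disjoint P" "\<Union>P = ?V"
    "\<And>A. A \<in> P \<Longrightarrow> A \<noteq> {}" "\<And>A. A \<in> P \<Longrightarrow> closed A"
    using infinite_components_clopen_partition[OF \<open>infinite (components ?V)\<close>, of K]
      closedin_closed_trans[OF _ clV] by metis
  obtain N where N: "\<And>A. A \<in> P \<Longrightarrow> open (N A)" "\<And>A. A \<in> P \<Longrightarrow> A \<subseteq> N A"
    "\<And>A B. A \<in> P \<Longrightarrow> B \<in> P \<Longrightarrow> A \<noteq> B \<Longrightarrow> N A \<inter> N B = {}"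
    using disjoint_closed_family_separation[OF P(1,3,6,5)] by blast
  define S :: "'a \<Rightarrow> real" where "S = (\<lambda>x. \<Sum>b\<in>Basis. (x \<bullet> b) ^ Suc q)"
  have evq: "even (Suc q)" by (simp add: q_def)
  have contS: "continuous_on UNIV S" unfolding S_def by (intro continuous_intros)
  obtain v where v: "\<And>A. A \<in> P \<Longrightarrow> v A \<in> A" using P(5) by (metis ex_in_conv)
  \<comment> \<open>The summand 1 makes \<open>S (v A) < \<rho>\<close> strict for every chosen
    point and keeps \<open>\<rho>\<close> positive.\<close>
  define \<rho> where "\<rho> = 1 + (\<Sum>A\<in>P. \<bar>S (v A)\<bar>)"
  have S_v: "S (v A) < \<rho>" if "A \<in> P" for A
  proof -
    have "\<bar>S (v A)\<bar> \<le> (\<Sum>A\<in>P. \<bar>S (v A)\<bar>)" using that P(1) by (intro member_le_sum) auto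
    then show ?thesis by (simp add: \<rho>_def)
  qed
  have "\<rho> > 0" unfolding \<rho>_def by (intro add_pos_nonneg sum_nonneg) auto
  define B where "B = {x. S x \<le> \<rho>}"
  have "compact B"
  proof -
    have "closed B" unfolding B_def by (intro closed_Collect_le contS continuous_intros)
    moreover have "bounded B"
    proof (rule bounded_subset[OF bounded_cbox])
      show "B \<subseteq> cbox (\<Sum>b\<in>Basis. - (1 + \<rho>) *\<^sub>R b) (\<Sum>b\<in>Basis. (1 + \<rho>) *\<^sub>R b)"
      proof
        fix x assume "x \<in> B"
        have "\<bar>x \<bullet> b\<bar> \<le> 1 + \<rho>" if "b \<in> Basis" for b
        proof (rule ccontr)
          assume "\<not> ?thesis"
          then have "1 + \<rho> < \<bar>x \<bullet> b\<bar>" by simp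
          also have "\<bar>x \<bullet> b\<bar> \<le> \<bar>x \<bullet> b\<bar> ^ Suc q"
            using \<open>1 + \<rho> < \<bar>x \<bullet> b\<bar>\<close> \<open>\<rho> > 0\<close> by (intro self_le_power) auto
          also have "\<dots> = (x \<bullet> b) ^ Suc q" using evq by (rule power_even_abs)
          also have "\<dots> \<le> S x"
            unfolding S_def using that evq by (intro member_le_sum) (auto simp del: power_Suc simp: zero_le_even_power)
          finally show False using \<open>x \<in> B\<close> by (simp add: B_def)
        qed
        then show "x \<in> cbox (\<Sum>b\<in>Basis. - (1 + \<rho>) *\<^sub>R b) (\<Sum>b\<in>Basis. (1 + \<rho>) *\<^sub>R b)"
          by (auto simp: mem_box abs_le_iff) (smt (verit))+
      qed
    qed
    ultimately show ?thesis by (simp add: compact_eq_bounded_closed)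
  qed
  \<comment> \<open>On this compact remainder \<open>G\<close> has no zeros, hence a positive lower
    bound \<open>\<eta>\<close>.\<close>
  define A0 where "A0 = B - (\<Union>A\<in>P. N A)"
  have "compact A0"
    unfolding A0_def using N(1) \<open>compact B\<close> by (intro compact_diff open_UN ballI)
  obtain \<eta> where "\<eta> > 0" and \<eta>: "\<And>x. x \<in> A0 \<Longrightarrow> G x \<ge> \<eta>"
  proof (cases "A0 = {}")
    case True
    then show ?thesis using that[of 1] by auto
  next
    case False
    then obtain x0 where x0: "x0 \<in> A0" "\<And>x. x \<in> A0 \<Longrightarrow> G x0 \<le> G x"
      using continuous_attains_inf[OF \<open>compact A0\<close>] continuous_on_subset[OF contG] by (metis top_greatest)
    have "x0 \<notin> \<Union>P" using x0(1) N(2) by (auto simp: A0_def)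
    then have "x0 \<notin> ?V" by (simp only: P(4) not_False_eq_True)
    then have "G x0 > 0" using nonneg[of x0] by simp
    then show ?thesis using x0 that by blast
  qed
  \<comment> \<open>Since \<open>S \<ge> 0\<close>, the subtracted term is at most
    \<open>\<epsilon> * \<rho> = \<eta> / 2\<close>, too small to make \<open>H\<close> negative on
    \<open>A0\<close>.\<close>
  define \<epsilon> where "\<epsilon> = \<eta> / (2 * \<rho>)"
  have "\<epsilon> > 0" using \<open>\<eta> > 0\<close> \<open>\<rho> > 0\<close> by (simp add: \<epsilon>_def)
  define H where "H = (\<lambda>x. G x - \<epsilon> * (\<rho> - S x))"
  have contH: "continuous_on UNIV H" unfolding H_def by (intro continuous_intros contG contS)
  have derH: "(H has_derivative (\<lambda>h. \<Sum>b\<in>Basis. (h \<bullet> b) * (g b x + \<epsilon> * (real (Suc q) * (x \<bullet> b) ^ q)))) (at x)" for x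
  proof -
    have pow: "((\<lambda>x. (x \<bullet> b) ^ Suc q) has_derivative (\<lambda>h. real (Suc q) * (h \<bullet> b) * (x \<bullet> b) ^ q)) (at x)" for b
      by (rule derivative_eq_intros refl)+ (simp add: mult_ac)
    have "(H has_derivative (\<lambda>h. (\<Sum>b\<in>Basis. (h \<bullet> b) * g b x) -
        \<epsilon> * (0 - (\<Sum>b\<in>Basis. real (Suc q) * (h \<bullet> b) * (x \<bullet> b) ^ q)))) (at x)"
      unfolding H_def S_def
      by (intro has_derivative_diff g(1) has_derivative_mult_right has_derivative_const has_derivative_sum pow)
    then show ?thesis
      by (rule has_derivative_eq_rhs)
         (simp add: sum_distrib_left sum.distrib[symmetric] distrib_left mult_ac del: of_nat_Suc)
  qed
  have crit: "\<exists>z\<in>N A. \<forall>b\<in>Basis. (z \<bullet> b) ^ q = - 1 / (\<epsilon> * real (Suc q)) * g b z" if A: "A \<in> P" for A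
  proof -
    \<comment> \<open>Only the neighbourhoods of the other pieces are removed, which keeps
      \<open>D\<close> compact. A minimum point of \<open>H\<close> on \<open>D\<close> has a
      negative value, and this excludes both \<open>S z \<ge> \<rho>\<close> and \<open>A0\<close>;
      the point thus lies in an open subset of \<open>D\<close> and is critical.\<close>
    define D where "D = B - (\<Union>A'\<in>P - {A}. N A')"
    have "compact D"
      unfolding D_def using N(1) \<open>compact B\<close> by (intro compact_diff open_UN ballI) blast+
    have vD: "v A \<in> D"
      using A N(2,3) v S_v by (fastforce simp: D_def B_def less_imp_le)
    obtain z where z: "z \<in> D" "\<And>x. x \<in> D \<Longrightarrow> H z \<le> H x"
      using continuous_attains_inf[OF \<open>compact D\<close>] vD continuous_on_subset[OF contH] by (metis empty_iff top_greatest)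
    have "v A \<in> ?V" using v[OF A] A P(4) by blast
    then have "G (v A) = 0" by simp
    then have "H (v A) < 0"
      using S_v[OF A] \<open>\<epsilon> > 0\<close> by (simp add: H_def)
    then have Hz: "H z < 0" using z(2)[OF vD] by simp
    have "S z < \<rho>"
    proof (rule ccontr)
      assume "\<not> ?thesis"
      then have "\<epsilon> * (\<rho> - S z) \<le> 0" using \<open>\<epsilon> > 0\<close> by (simp add: mult_le_0_iff)
      then show False using Hz nonneg[of z] by (simp add: H_def)
    qed
    have "z \<notin> A0"
    proof
      assume "z \<in> A0"
      have "S z \<ge> 0" unfolding S_def using evq by (intro sum_nonneg zero_le_even_power) auto
      then have "\<epsilon> * (\<rho> - S z) \<le> \<epsilon> * \<rho>" using \<open>\<epsilon> > 0\<close> by simp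
      also have "\<dots> < \<eta>" using \<open>\<eta> > 0\<close> \<open>\<rho> > 0\<close> by (simp add: \<epsilon>_def)
      finally show False using \<eta>[OF \<open>z \<in> A0\<close>] Hz by (simp add: H_def)
    qed
    then have zN: "z \<in> N A" using z(1) by (auto simp: A0_def D_def)
    define O' where "O' = N A \<inter> {x. S x < \<rho>}"
    have "open O'"
      unfolding O'_def using N(1)[OF A] by (intro open_Int open_Collect_less contS continuous_intros)
    moreover have "z \<in> O'" using zN \<open>S z < \<rho>\<close> by (simp add: O'_def)
    moreover have "O' \<subseteq> D" using N(3)[OF A] by (auto simp: O'_def D_def B_def)
    ultimately have "(\<lambda>h. \<Sum>b\<in>Basis. (h \<bullet> b) * (g b z + \<epsilon> * (real (Suc q) * (z \<bullet> b) ^ q))) = (\<lambda>h. 0)"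
      by (intro differential_zero_maxmin[OF _ _ derH]) (use z(2) in auto)
    then have 0: "(\<Sum>c\<in>Basis. (b \<bullet> c) * (g c z + \<epsilon> * (real (Suc q) * (z \<bullet> c) ^ q))) = 0" for b
      by meson
    have "(z \<bullet> b) ^ q = - 1 / (\<epsilon> * real (Suc q)) * g b z" if b: "b \<in> Basis" for b
    proof -
      have "g b z + \<epsilon> * (real (Suc q) * (z \<bullet> b) ^ q) = 0"
        using 0[of b] b by (simp add: inner_Basis if_distrib[of "\<lambda>x. x * _"] cong: if_cong)
      then show ?thesis using \<open>\<epsilon> > 0\<close>
        by (simp add: field_simps del: of_nat_Suc)
    qed
    then show ?thesis using zN by blast
  qed
  then obtain z where z: "\<And>A. A \<in> P \<Longrightarrow> z A \<in> N A"
    "\<And>A b. A \<in> P \<Longrightarrow> b \<in> Basis \<Longrightarrow> (z A \<bullet> b) ^ q = - 1 / (\<epsilon> * real (Suc q)) * g b (z A)"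
    by metis
  have "inj_on z P"
    using z(1) N(3) by (intro inj_onI) (metis disjoint_iff)
  have "card (z ` P) \<le> K"
    unfolding K_def
  proof (rule card_common_zeros_le)
    show "(x \<bullet> b) ^ q = - 1 / (\<epsilon> * real (Suc q)) * g b x" if "b \<in> Basis" "x \<in> z ` P" for b x
      using that z(2) by blast
    show "poly_deg_le d (\<lambda>x. - 1 / (\<epsilon> * real (Suc q)) * g b x)" if "b \<in> Basis" for b
      using g(2)[OF that] by (rule poly_deg_le_cmult)
  qed (use P(1) in \<open>auto simp: q_def\<close>)
  then show False using \<open>inj_on z P\<close> P(2) by (simp add: card_image)
qed

section \<open>Continuous images and differences of zero sets\<close>

text \<open>Sending a component of \<open>S\<close> to the component of the image that contains its
  image is onto.\<close>

lemma finite_components_continuous_image: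
  assumes "finite (components S)" "continuous_on S f"
  shows "finite (components (f ` S))"
proof -
  have "\<forall>C\<in>components S. \<exists>D\<in>components (f ` S). f ` C \<subseteq> D"
  proof
    fix C assume C: "C \<in> components S"
    then have "connected (f ` C)" "f ` C \<noteq> {}" "f ` C \<subseteq> f ` S"
      using assms(2) in_components_connected in_components_nonempty in_components_subset
        connected_continuous_image continuous_on_subset
      by (metis, blast, blast)
    then show "\<exists>D\<in>components (f ` S). f ` C \<subseteq> D"
      by (metis exists_component_superset image_is_empty subset_empty)
  qed
  then obtain D where D: "\<And>C. C \<in> components S \<Longrightarrow> D C \<in> components (f ` S) \<and> f ` C \<subseteq> D C"
    by metis
  have "components (f ` S) \<subseteq> D ` components S"
  proof
    fix E assume E: "E \<in> components (f ` S)"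
    then obtain x where "x \<in> S" "f x \<in> E"
      using in_components_nonempty in_components_subset by (metis ex_in_conv image_iff subset_iff)
    then obtain C where C: "C \<in> components S" "x \<in> C" by (metis UnionE Union_components)
    then have "E = D C"
      using D[OF C(1)] E \<open>f x \<in> E\<close> components_eq by blast
    then show "E \<in> D ` components S" using C by blast
  qed
  then show ?thesis using assms(1) finite_surj by blast
qed

text \<open>Rabinowitsch's trick: the difference is the projection of the set given by
  \<open>F x = 0\<close> and \<open>t * g x = 1\<close> in one more dimension, and adding squares
  turns the two equations into one nonnegative polynomial.\<close>

lemma finite_components_zeros_diff:
  fixes F g :: "'a::euclidean_space \<Rightarrow> real"
  assumes F: "real_polynomial_function F" and g: "real_polynomial_function g"
  shows "finite (components ({x. F x = 0} - {x. g x = 0}))"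
proof -
  let ?G = "\<lambda>z::'a \<times> real. (F (fst z))\<^sup>2 + (snd z * g (fst z) - 1)\<^sup>2"
  have pF: "real_polynomial_function (\<lambda>z::'a \<times> real. h (fst z))" if "real_polynomial_function h" for h
    using real_polynomial_function_compose[OF polynomial_function_bounded_linear[OF bounded_linear_fst] that]
    by (simp add: o_def)
  have "finite (components {z. ?G z = 0})"
    by (rule finite_components_zeros_nonneg)
       (intro real_polynomial_function.intros(2-) real_polynomial_function_power real_polynomial_function_diff
          pF F g real_polynomial_function.intros(1)[OF bounded_linear_snd], simp)
  then have "finite (components (fst ` {z. ?G z = 0}))"
    by (rule finite_components_continuous_image) (intro continuous_intros)
  also have "fst ` {z. ?G z = 0} = {x. F x = 0} - {x. g x = 0}"
  proof (intro equalityI subsetI)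
    fix x assume "x \<in> {x. F x = 0} - {x. g x = 0}"
    then have "x = fst (x, 1 / g x)" "?G (x, 1 / g x) = 0" by auto
    then show "x \<in> fst ` {z. ?G z = 0}" by blast
  qed (auto simp: sum_power2_eq_zero_iff)
  finally show ?thesis .
qed

section \<open>Zero sets of ideals\<close>

lemma mpoly_eval_superset:
  assumes "finite S" "Poly_Mapping.keys p \<subseteq> S"
  shows "mpoly_eval p x = (\<Sum>\<alpha>\<in>S. Poly_Mapping.lookup p \<alpha> * (\<Prod>i\<in>UNIV. (x $ i) ^ Poly_Mapping.lookup \<alpha> i))"
  unfolding mpoly_eval_def
  using assms by (intro sum.mono_neutral_left) (auto simp: in_keys_iff)

lemma mpoly_eval_add: "mpoly_eval (p + q) x = mpoly_eval p x + mpoly_eval q x"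
proof -
  let ?S = "Poly_Mapping.keys p \<union> Poly_Mapping.keys q"
  have "finite ?S" by simp
  moreover have "Poly_Mapping.keys (p + q) \<subseteq> ?S" by (rule Poly_Mapping.keys_add)
  ultimately show ?thesis
    by (simp add: mpoly_eval_superset[of ?S] lookup_add distrib_right sum.distrib)
qed

lemma lookup_single_mult:
  fixes p :: "('a::cancel_comm_monoid_add \<Rightarrow>\<^sub>0 'b::comm_ring_1)"
  shows "Poly_Mapping.lookup (Poly_Mapping.single \<gamma> c * p) (\<gamma> + \<alpha>) = c * Poly_Mapping.lookup p \<alpha>"
proof -
  have "(\<Sum>l. (c when \<gamma> = l) * (\<Sum>q. Poly_Mapping.lookup p q when \<gamma> + \<alpha> = l + q))
      = (\<Sum>l. c * (\<Sum>q. Poly_Mapping.lookup p q when \<alpha> = q) when l = \<gamma>)"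
    by (rule Sum_any.cong) (auto simp: when_def)
  then show ?thesis by (simp add: lookup_mult lookup_single)
qed

lemma keys_single_mult:
  "Poly_Mapping.keys (Poly_Mapping.single \<gamma> c * p) \<subseteq> (+) \<gamma> ` Poly_Mapping.keys p"
  using Poly_Mapping.keys_mult[of "Poly_Mapping.single \<gamma> c" p] by (auto split: if_splits)

lemma mpoly_eval_single_mult:
  fixes p :: "('n::finite, 'a::comm_ring_1) mpoly"
  shows "mpoly_eval (Poly_Mapping.single \<gamma> c * p) x =
     c * (\<Prod>i\<in>UNIV. (x $ i) ^ Poly_Mapping.lookup \<gamma> i) * mpoly_eval p x"
proof -
  have "mpoly_eval (Poly_Mapping.single \<gamma> c * p) x =
    (\<Sum>\<alpha>\<in>(+) \<gamma> ` Poly_Mapping.keys p. Poly_Mapping.lookup (Poly_Mapping.single \<gamma> c * p) \<alpha> *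
       (\<Prod>i\<in>UNIV. (x $ i) ^ Poly_Mapping.lookup \<alpha> i))"
    by (rule mpoly_eval_superset) (auto intro: subsetD[OF keys_single_mult])
  also have "\<dots> = (\<Sum>\<alpha>\<in>Poly_Mapping.keys p. c * Poly_Mapping.lookup p \<alpha> *
       (\<Prod>i\<in>UNIV. (x $ i) ^ Poly_Mapping.lookup (\<gamma> + \<alpha>) i))"
    by (subst sum.reindex) (auto simp: lookup_single_mult)
  also have "\<dots> = c * (\<Prod>i\<in>UNIV. (x $ i) ^ Poly_Mapping.lookup \<gamma> i) * mpoly_eval p x"
    by (auto simp: mpoly_eval_def sum_distrib_left lookup_add power_add prod.distrib mult_ac intro!: sum.cong)
  finally show ?thesis .
qed

lemma real_polynomial_function_mpoly_eval:
  fixes p :: "('n::finite, real) mpoly"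
  shows "real_polynomial_function (mpoly_eval p)"
proof -
  have "real_polynomial_function (\<lambda>x::real^'n. x $ i)" for i
    by (rule real_polynomial_function.intros(1)) (rule bounded_linear_vec_nth)
  then show ?thesis
    unfolding mpoly_eval_def[abs_def]
    by (intro real_polynomial_function_sum real_polynomial_function.intros(2-)
        real_polynomial_function_prod real_polynomial_function_power) auto
qed

section \<open>Finite systems of equations\<close>

text \<open>Passing to a subsequence for one coordinate after another makes all coordinates
  nondecreasing; the first two terms of the final subsequence are the pair.\<close>

lemma dickson_pair:
  fixes s :: "nat \<Rightarrow> 'n::finite \<Rightarrow> nat"
  shows "\<exists>j k. j < k \<and> (\<forall>i. s j i \<le> s k i)"
proof -
  have "\<exists>r::nat\<Rightarrow>nat. strict_mono r \<and> (\<forall>i\<in>A. mono (\<lambda>k. s (r k) i))" if "finite A" for A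
    using that
  proof (induction A rule: finite_induct)
    case empty
    show ?case using strict_mono_id by auto
  next
    case (insert a A)
    then obtain r :: "nat \<Rightarrow> nat" where r: "strict_mono r" "\<forall>i\<in>A. mono (\<lambda>k. s (r k) i)" by blast
    obtain f :: "nat \<Rightarrow> nat" where f: "strict_mono f" "monoseq (\<lambda>k. s (r (f k)) a)"
      using seq_monosub[of "\<lambda>k. s (r k) a"] by auto
    \<comment> \<open>A nonincreasing sequence of naturals is constant from the index of its least
      value on, so dropping an initial segment leaves a nondecreasing one.\<close>
    have "\<exists>N. \<forall>k\<ge>N. \<forall>l\<ge>k. s (r (f k)) a \<le> s (r (f l)) a"
    proof (cases "\<forall>m n. m \<le> n \<longrightarrow> s (r (f m)) a \<le> s (r (f n)) a")
      case False
      then have dec: "m \<le> n \<Longrightarrow> s (r (f n)) a \<le> s (r (f m)) a" for m n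
        using f(2) by (auto simp: monoseq_def)
      obtain N where "\<forall>n. s (r (f N)) a \<le> s (r (f n)) a"
        using ex_has_least_nat[of "\<lambda>_. True" 0 "\<lambda>n. s (r (f n)) a"] by auto
      then show ?thesis using dec by (intro exI[of _ N]) (metis order_trans)
    qed auto
    then obtain N where N: "\<And>k l. N \<le> k \<Longrightarrow> k \<le> l \<Longrightarrow> s (r (f k)) a \<le> s (r (f l)) a" by blast
    let ?r = "\<lambda>k. r (f (k + N))"
    have mono_f: "mono (\<lambda>k. f (k + N))"
      using f(1) by (auto intro!: monoI simp: strict_mono_less_eq)
    have "strict_mono ?r" using r(1) f(1) by (auto simp: strict_mono_def)
    moreover have "mono (\<lambda>k. s (?r k) a)" using N by (auto intro!: monoI)
    moreover have "mono (\<lambda>k. s (?r k) i)" if "i \<in> A" for i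
      using r(2) that mono_f unfolding mono_def by blast
    ultimately show ?case by blast
  qed
  from this[of UNIV] obtain r :: "nat \<Rightarrow> nat" where r: "strict_mono r" "\<forall>i. mono (\<lambda>k. s (r k) i)" by auto
  have "r 0 < r 1" using r(1) by (simp add: strict_mono_def)
  moreover have "s (r 0) i \<le> s (r 1) i" for i using r(2) by (simp add: mono_def)
  ultimately show ?thesis by blast
qed

text \<open>Unique factorization makes \<open>\<alpha> \<mapsto> \<Prod>i. p\<^sub>i ^ \<alpha> i\<close>, for distinct primes \<open>p\<^sub>i\<close>, an injective
  homomorphism into the positive naturals, and hence a monomial order of type \<open>\<omega>\<close>.\<close>

lemma monomial_order_exists:
  "\<exists>w :: ('n::finite \<Rightarrow>\<^sub>0 nat) \<Rightarrow> nat. inj w \<and> (\<forall>\<alpha> \<beta>. w (\<alpha> + \<beta>) = w \<alpha> * w \<beta>) \<and> (\<forall>\<alpha>. w \<alpha> > 0)"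
proof -
  have "infinite {p::nat. prime p}" by (rule primes_infinite)
  then obtain p :: "nat \<Rightarrow> nat" where p: "inj p" "range p \<subseteq> {p. prime p}"
    using infinite_countable_subset by blast
  obtain h :: "'n \<Rightarrow> nat" where h: "inj h" using finite_imp_inj_to_nat_seg[of "UNIV :: 'n set"] by auto
  define P where "P i = p (h i)" for i
  have P: "prime (P i)" "P i = P j \<longleftrightarrow> i = j" for i j
    using p h by (auto simp: P_def inj_eq)
  define w where "w \<alpha> = (\<Prod>i\<in>UNIV. P i ^ Poly_Mapping.lookup \<alpha> i)" for \<alpha> :: "'n \<Rightarrow>\<^sub>0 nat"
  have mult: "multiplicity (P i) (w \<alpha>) = Poly_Mapping.lookup \<alpha> i" for i \<alpha>
  proof -
    have "multiplicity (P i) (w \<alpha>) = (\<Sum>j\<in>UNIV. multiplicity (P i) (P j ^ Poly_Mapping.lookup \<alpha> j))"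
      unfolding w_def using P(1) prime_gt_0_nat[OF P(1)]
      by (intro prime_elem_multiplicity_prod_distrib) (auto simp: image_iff)
    also have "\<dots> = (\<Sum>j\<in>UNIV. if j = i then Poly_Mapping.lookup \<alpha> i else 0)"
      using P by (intro sum.cong) (auto simp: multiplicity_distinct_prime_power)
    finally show ?thesis by simp
  qed
  have "inj w"
    by (rule injI) (metis mult poly_mapping_eqI)
  moreover have "w (\<alpha> + \<beta>) = w \<alpha> * w \<beta>" for \<alpha> \<beta>
    by (simp add: w_def lookup_add power_add prod.distrib)
  moreover have "w \<alpha> > 0" for \<alpha>
    unfolding w_def by (intro prod_pos) (simp add: P(1) prime_gt_0_nat)
  ultimately show ?thesis by blast
qed

text \<open>A polynomial of least leading monomial among those not vanishing on the zero set of its predecessors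
  cannot be reduced by them, which contradicts Dickson's lemma.\<close>

lemma zero_set_ideal_finite:
  fixes I :: "('n::finite, 'a::field) mpoly set"
  assumes "is_ideal I"
  obtains F where "finite F" "F \<subseteq> I" "zero_set F = zero_set I"
proof -
  have "\<exists>F. finite F \<and> F \<subseteq> I \<and> zero_set F = zero_set I"
  proof (rule ccontr)
    assume "\<not> ?thesis"
    then have "zero_set F \<noteq> zero_set I" if "finite F" "F \<subseteq> I" for F
      using that by blast
    moreover have "zero_set I \<subseteq> zero_set F" if "F \<subseteq> I" for F
      using that by (auto simp: zero_set_def)
    ultimately have ex: "\<exists>f\<in>I. \<exists>x\<in>zero_set F. mpoly_eval f x \<noteq> 0" if "finite F" "F \<subseteq> I" for F
      using that by (fastforce simp: zero_set_def)
    obtain w :: "('n \<Rightarrow>\<^sub>0 nat) \<Rightarrow> nat" where w: "inj w" "\<And>\<alpha> \<beta>. w (\<alpha> + \<beta>) = w \<alpha> * w \<beta>" "\<And>\<alpha>. w \<alpha> > 0"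
      using monomial_order_exists by metis
    \<comment> \<open>The weight of the leading monomial, which is unique because \<open>w\<close>
      is injective.\<close>
    define lw where "lw f = Max (w ` Poly_Mapping.keys f)" for f :: "('n, 'a) mpoly"
    define good where "good F f \<longleftrightarrow> f \<in> I \<and> (\<exists>x\<in>zero_set F. mpoly_eval f x \<noteq> 0)" for F f
    define pick where "pick F = arg_min lw (good F)" for F
    have pick: "good F (pick F)" "\<And>f. good F f \<Longrightarrow> lw (pick F) \<le> lw f" if "finite F" "F \<subseteq> I" for F
      using arg_min_nat_lemma[of "good F" _ lw] ex[OF that] unfolding pick_def good_def by blast+
    define Fs where "Fs = rec_nat {} (\<lambda>_ F. insert (pick F) F)"
    have Fs: "Fs 0 = {}" "\<And>k. Fs (Suc k) = insert (pick (Fs k)) (Fs k)" by (simp_all add: Fs_def)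
    have FsI: "finite (Fs k) \<and> Fs k \<subseteq> I" for k
      by (induction k) (use Fs pick(1) in \<open>auto simp: good_def\<close>)
    have Fs_mono: "Fs j \<subseteq> Fs k" if "j \<le> k" for j k
      using that by (rule lift_Suc_mono_le[rotated]) (auto simp: Fs)
    define f where "f k = pick (Fs k)" for k
    have f: "good (Fs k) (f k)" "\<And>g. good (Fs k) g \<Longrightarrow> lw (f k) \<le> lw g" for k
      using pick FsI by (auto simp: f_def)
    have f_mem: "f j \<in> Fs k" if "j < k" for j k
      using Fs_mono[of "Suc j" k] that by (auto simp: Fs f_def)
    have keys: "Poly_Mapping.keys (f k) \<noteq> {}" for k
      using f(1)[of k] by (auto simp: good_def mpoly_eval_def)
    have "\<exists>\<alpha>\<in>Poly_Mapping.keys (f k). w \<alpha> = lw (f k)" for k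
      using Max_in[of "w ` Poly_Mapping.keys (f k)"] keys[of k] unfolding lw_def by fastforce
    then obtain lm where lm: "\<And>k. lm k \<in> Poly_Mapping.keys (f k)" "\<And>k. w (lm k) = lw (f k)" by metis
    obtain j k where jk: "j < k" "\<And>i. Poly_Mapping.lookup (lm j) i \<le> Poly_Mapping.lookup (lm k) i"
      using dickson_pair[of "\<lambda>k. Poly_Mapping.lookup (lm k)"] by blast
    \<comment> \<open>Truncated subtraction, exact because \<open>lm j\<close> divides
      \<open>lm k\<close>.\<close>
    define \<gamma> where "\<gamma> = lm k - lm j"
    have \<gamma>: "\<gamma> + lm j = lm k"
      by (rule poly_mapping_eqI) (simp add: \<gamma>_def lookup_add lookup_minus jk(2))
    \<comment> \<open>Chosen to cancel the coefficient of \<open>lm k\<close>. Adding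
      \<open>h\<close> keeps the value at \<open>x\<close>, where \<open>f j\<close> vanishes, so
      \<open>f k + h\<close> competes with \<open>f k\<close>, yet its leading monomial would be
      smaller.\<close>
    define c where "c = - Poly_Mapping.lookup (f k) (lm k) / Poly_Mapping.lookup (f j) (lm j)"
    define h where "h = Poly_Mapping.single \<gamma> c * f j"
    have "f j \<in> I" "f k \<in> I" using f(1) by (auto simp: good_def)
    then have "f k + h \<in> I" using assms by (auto simp: is_ideal_def h_def)
    obtain x where x: "x \<in> zero_set (Fs k)" "mpoly_eval (f k) x \<noteq> 0"
      using f(1) unfolding good_def by blast
    have "mpoly_eval (f j) x = 0" using x(1) f_mem[OF jk(1)] by (auto simp: zero_set_def)
    then have ev: "mpoly_eval (f k + h) x = mpoly_eval (f k) x"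
      by (simp add: mpoly_eval_add h_def mpoly_eval_single_mult)
    with \<open>f k + h \<in> I\<close> x have "good (Fs k) (f k + h)" unfolding good_def by (metis ev)
    then have "lw (f k) \<le> lw (f k + h)" by (rule f(2))
    have "Poly_Mapping.keys (f k + h) \<noteq> {}"
      using ev x(2) by (auto simp: mpoly_eval_def)
    then obtain \<beta> where \<beta>: "\<beta> \<in> Poly_Mapping.keys (f k + h)" "w \<beta> = lw (f k + h)"
      using Max_in[of "w ` Poly_Mapping.keys (f k + h)"] unfolding lw_def by (auto simp del: Max_in)
    have "w \<beta> \<le> w (lm k)"
    proof -
      have "\<beta> \<in> Poly_Mapping.keys (f k) \<or> \<beta> \<in> Poly_Mapping.keys h"
        using subsetD[OF Poly_Mapping.keys_add[of "f k" h] \<beta>(1)] by simp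
      then show ?thesis
      proof
        assume "\<beta> \<in> Poly_Mapping.keys (f k)"
        then show ?thesis unfolding lm(2) lw_def by (intro Max_ge) auto
      next
        assume "\<beta> \<in> Poly_Mapping.keys h"
        then obtain \<delta> where \<delta>: "\<delta> \<in> Poly_Mapping.keys (f j)" "\<beta> = \<gamma> + \<delta>"
          using subsetD[OF keys_single_mult, of \<beta> \<gamma> c "f j"] unfolding h_def by blast
        have "w \<delta> \<le> w (lm j)" unfolding lm(2) lw_def using \<delta>(1) by (intro Max_ge) auto
        then show ?thesis by (simp add: \<delta>(2) w(2) flip: \<gamma>)
      qed
    qed
    then have "w \<beta> = w (lm k)" using \<open>lw (f k) \<le> lw (f k + h)\<close> \<beta>(2) lm(2) by simp
    then have "\<beta> = lm k" using w(1) by (simp add: inj_eq)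
    moreover have "Poly_Mapping.lookup (f k + h) (lm k) = 0"
    proof -
      have "Poly_Mapping.lookup h (lm k) = c * Poly_Mapping.lookup (f j) (lm j)"
        unfolding h_def \<gamma>[symmetric] by (rule lookup_single_mult)
      moreover have "Poly_Mapping.lookup (f j) (lm j) \<noteq> 0" using lm(1) by (simp add: in_keys_iff)
      ultimately show ?thesis by (simp add: lookup_add c_def)
    qed
    ultimately show False using \<beta>(1) by (simp add: in_keys_iff)
  qed
  then show ?thesis using that by blast
qed

text \<open>Over the reals a finite system has the same zeros as its sum of squares; the ideal
  property serves to make the system finite.\<close>

lemma zero_set_ideal_single_real_polynomial:
  fixes I :: "('n::finite, real) mpoly set"
  assumes "is_ideal I"
  obtains F where "real_polynomial_function F" "zero_set I = {x. F x = 0}"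
proof -
  obtain B where B: "finite B" "zero_set B = zero_set I"
    using zero_set_ideal_finite[OF assms] by metis
  let ?F = "\<lambda>x. \<Sum>g\<in>B. (mpoly_eval g x)\<^sup>2"
  have "real_polynomial_function ?F"
    using B(1) real_polynomial_function_mpoly_eval
    by (intro real_polynomial_function_sum real_polynomial_function_power) auto
  moreover have "zero_set I = {x. ?F x = 0}"
    using B by (auto simp: zero_set_def sum_nonneg_eq_0_iff)
  ultimately show ?thesis using that by blast
qed

section \<open>Holomorphic maps in several variables\<close>

lemma norm_vector_scalar_mult: "norm (c *s v) = norm c * norm (v :: complex ^ 'n::finite)"
proof -
  have "norm (c *s v) = L2_set (\<lambda>i. norm c * norm (v $ i)) UNIV"
    by (simp add: norm_vec_def norm_mult)
  then show ?thesis by (simp add: L2_set_right_distrib norm_vec_def)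
qed

lemma bounded_linear_vector_scalar_mult_left: "bounded_linear (\<lambda>c. c *s (v :: complex ^ 'n::finite))"
  by (rule bounded_linear_intro[of _ "norm v"])
     (auto simp: vec_eq_iff distrib_right norm_vector_scalar_mult mult.commute)

lemma has_derivative_vec_lambda:
  fixes f :: "'i::finite \<Rightarrow> 'a::real_normed_vector \<Rightarrow> 'b::euclidean_space"
  assumes "\<And>i. (f i has_derivative f' i) (at x)"
  shows "((\<lambda>x. \<chi> i. f i x) has_derivative (\<lambda>h. \<chi> i. f' i h)) (at x)"
proof -
  have ax: "(\<chi> i. g i) = (\<Sum>i\<in>UNIV. axis i (g i))" for g :: "'i \<Rightarrow> 'b"
    by (simp add: vec_eq_iff axis_def if_distrib sum.delta cong: if_cong)
  have "bounded_linear (axis i :: 'b \<Rightarrow> 'b ^ 'i)" for i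
    unfolding linear_conv_bounded_linear[symmetric]
    by (rule linearI) (simp_all add: axis_def vec_eq_iff)
  then have "((\<lambda>x. \<Sum>i\<in>UNIV. axis i (f i x)) has_derivative (\<lambda>h. \<Sum>i\<in>UNIV. axis i (f' i h))) (at x)"
    by (rule has_derivative_sum[OF bounded_linear.has_derivative[OF _ assms]])
  then show ?thesis by (simp add: ax)
qed

section \<open>Complex differentiability of derivatives\<close>

text \<open>Cauchy's formula for the derivative of \<open>F (x + \<zeta> *s v)\<close> at
  \<open>\<zeta> = 0\<close>, written over the parameter interval of the circle. The integrand
  involves only values of \<open>F\<close>, so regularity of \<open>D x v\<close> in
  \<open>x\<close> can be read off under the integral sign.\<close>

lemma Cauchy_directional_derivative:
  fixes F :: "complex ^ 'n::finite \<Rightarrow> complex"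
  assumes "open S"
    and der: "\<And>x. x \<in> S \<Longrightarrow> (F has_derivative D x) (at x)"
    and lin: "\<And>x c w. x \<in> S \<Longrightarrow> D x (c *s w) = c * D x w"
    and "\<rho> > 0" and S: "\<And>\<zeta>. norm \<zeta> \<le> \<rho> \<Longrightarrow> x + \<zeta> *s v \<in> S"
  shows "((\<lambda>t. F (x + (of_real \<rho> * exp (2 * pi * \<i> * of_real t)) *s v) /
      (of_real \<rho> * exp (2 * pi * \<i> * of_real t))) has_integral D x v) {0..1}"
proof -
  let ?h = "\<lambda>\<zeta>. F (x + \<zeta> *s v)"
  have h: "(?h has_field_derivative D (x + \<zeta> *s v) v) (at \<zeta>)" if "x + \<zeta> *s v \<in> S" for \<zeta>
  proof -
    have "((\<lambda>\<zeta>. x + \<zeta> *s v) has_derivative (\<lambda>c. c *s v)) (at \<zeta>)"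
      by (auto intro!: derivative_eq_intros bounded_linear.has_derivative[OF bounded_linear_vector_scalar_mult_left])
    then have "(?h has_derivative (\<lambda>c. D (x + \<zeta> *s v) (c *s v))) (at \<zeta>)"
      using der[OF that] by (rule has_derivative_compose)
    then show ?thesis
      using lin[OF that] by (simp add: has_field_derivative_def mult.commute[of _ "D _ _"])
  qed
  have h': "?h field_differentiable at \<zeta>" if "norm \<zeta> \<le> \<rho>" for \<zeta>
    using h[OF S[OF that]] field_differentiable_def by blast
  have "continuous_on (cball 0 \<rho>) ?h"
    using h' by (intro continuous_at_imp_continuous_on) (auto intro: field_differentiable_imp_continuous_at)
  moreover have "?h holomorphic_on ball 0 \<rho>"
    using h' by (auto simp: holomorphic_on_def intro: field_differentiable_at_within)
  moreover have "0 \<in> ball (0::complex) \<rho>" using \<open>\<rho> > 0\<close> by simp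
  ultimately have "((\<lambda>u. ?h u / (u - 0) ^ Suc 1) has_contour_integral
      ((2 * pi * \<i>) / (fact 1) * (deriv ^^ 1) ?h 0)) (circlepath 0 \<rho>)"
    by (rule Cauchy_has_contour_integral_higher_derivative_circlepath)
  moreover have "deriv ?h 0 = D x v"
    using h[of 0] S[of 0] \<open>\<rho> > 0\<close> by (auto intro!: DERIV_imp_deriv)
  ultimately have "((\<lambda>t. ?h (circlepath 0 \<rho> t) / (circlepath 0 \<rho> t)\<^sup>2 * (2 * pi * \<i> * \<rho> * exp (2 * of_real pi * \<i> * t)))
      has_integral (2 * pi * \<i> * D x v)) {0..1}"
    by (simp add: has_contour_integral vector_derivative_circlepath numeral_2_eq_2)
  then have "((\<lambda>t. 1 / (2 * pi * \<i>) * (?h (circlepath 0 \<rho> t) / (circlepath 0 \<rho> t)\<^sup>2 *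
       (2 * pi * \<i> * \<rho> * exp (2 * of_real pi * \<i> * t))))
      has_integral 1 / (2 * pi * \<i>) * (2 * pi * \<i> * D x v)) {0..1}"
    by (rule has_integral_mult_right)
  moreover have "1 / (2 * pi * \<i>) * (?h (circlepath 0 \<rho> t) / (circlepath 0 \<rho> t)\<^sup>2 *
       (2 * pi * \<i> * \<rho> * exp (2 * of_real pi * \<i> * t))) =
     F (x + (of_real \<rho> * exp (2 * pi * \<i> * of_real t)) *s v) / (of_real \<rho> * exp (2 * pi * \<i> * of_real t))" for t
    using \<open>\<rho> > 0\<close> by (simp add: circlepath power2_eq_square field_simps)
  ultimately show ?thesis by simp
qed

text \<open>The integral formula is used twice. It shows that the derivative depends continuously on
  the point, and this continuity is what differentiation under the integral sign then asks of the
  integrand's derivative. Complex linearity passes from the integrand to the integral.\<close>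

lemma directional_derivative_differentiable:
  fixes F :: "complex ^ 'n::finite \<Rightarrow> complex"
  assumes "open S"
    and der: "\<And>x. x \<in> S \<Longrightarrow> (F has_derivative D x) (at x)"
    and lin: "\<And>x c w. x \<in> S \<Longrightarrow> D x (c *s w) = c * D x w"
    and x0: "x0 \<in> S"
  shows "\<exists>D'. ((\<lambda>x. D x v) has_derivative D') (at x0) \<and> (\<forall>c w. D' (c *s w) = c * D' w)"
proof -
  define e where "e \<rho> t = of_real \<rho> * exp (2 * pi * \<i> * of_real t)" for \<rho> t :: real
  have norm_e: "norm (e \<rho> t) = \<bar>\<rho>\<bar>" for \<rho> t by (simp add: e_def norm_mult)
  have cont_e: "continuous_on A (\<lambda>p. e \<rho> (g p))" if "continuous_on A g" for A \<rho> and g :: "'x::topological_space \<Rightarrow> real"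
    unfolding e_def by (intro continuous_intros that)
  have e0: "e \<rho> t \<noteq> 0" if "\<rho> > 0" for \<rho> t using that by (simp add: e_def)
  \<comment> \<open>One radius has to serve all points near \<open>y\<close>, since the circle must
    not vary with the point. Adding 1 to \<open>norm w\<close> avoids division by zero.\<close>
  have room: "\<exists>\<delta>>0. \<exists>\<rho>>0. \<forall>x\<in>ball y \<delta>. \<forall>\<zeta>. norm \<zeta> \<le> \<rho> \<longrightarrow> x + \<zeta> *s w \<in> S" if "y \<in> S" for y w
  proof -
    obtain r where r: "r > 0" "ball y r \<subseteq> S" using openE[OF \<open>open S\<close> \<open>y \<in> S\<close>] by blast
    have "x + \<zeta> *s w \<in> S" if "x \<in> ball y (r/2)" "norm \<zeta> \<le> r / (2 * (norm w + 1))" for x \<zeta>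
    proof -
      have "norm (\<zeta> *s w) \<le> r / (2 * (norm w + 1)) * (norm w + 1)"
        unfolding norm_vector_scalar_mult using that r by (intro mult_mono) auto
      also have "\<dots> = r / 2"
      proof -
        have "norm w + 1 > 0" by (simp add: add_nonneg_pos)
        then show ?thesis by (simp add: field_simps)
      qed
      finally have "dist y (x + \<zeta> *s w) < r"
        using that(1) norm_triangle_ineq4[of "y - x" "\<zeta> *s w"] by (simp add: dist_norm algebra_simps)
      then show ?thesis using r by auto
    qed
    moreover have "r / 2 > 0" "r / (2 * (norm w + 1)) > 0"
      using r by (simp_all add: add_nonneg_pos)
    ultimately show ?thesis by blast
  qed
  have contF: "continuous_on S F"
    using der has_derivative_continuous by (intro continuous_at_imp_continuous_on) blast
  have shift: "continuous_on (ball y \<delta> \<times> cbox 0 1) (\<lambda>(x, t). G (x + e \<rho> t *s w))"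
    if "continuous_on S G" "\<rho> > 0" "\<forall>x\<in>ball y \<delta>. \<forall>\<zeta>. norm \<zeta> \<le> \<rho> \<longrightarrow> x + \<zeta> *s w \<in> S"
    for G :: "complex ^ 'n \<Rightarrow> complex" and y \<delta> \<rho> w
    unfolding split_beta
  proof (rule continuous_on_compose2[OF that(1)])
    show "continuous_on (ball y \<delta> \<times> cbox 0 1) (\<lambda>p. fst p + e \<rho> (snd p) *s w)"
      by (intro continuous_intros bounded_linear.continuous_on[OF bounded_linear_vector_scalar_mult_left] cont_e)
    show "(\<lambda>p. fst p + e \<rho> (snd p) *s w) ` (ball y \<delta> \<times> cbox 0 1) \<subseteq> S"
      using that(2,3) by (auto simp: norm_e)
  qed
  have rep: "((\<lambda>t. F (x + e \<rho> t *s w) / e \<rho> t) has_integral D x w) (cbox 0 1)"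
    if "\<rho> > 0" "\<forall>\<zeta>. norm \<zeta> \<le> \<rho> \<longrightarrow> x + \<zeta> *s w \<in> S" for x \<rho> w
    using Cauchy_directional_derivative[of S F D \<rho> x w] \<open>open S\<close> der lin that
    by (simp add: e_def cbox_interval)
  have contD: "continuous_on S (\<lambda>x. D x w)" for w
  proof (intro continuous_at_imp_continuous_on ballI)
    fix y assume "y \<in> S"
    then obtain \<delta> \<rho> where *: "\<delta> > 0" "\<rho> > 0" "\<forall>x\<in>ball y \<delta>. \<forall>\<zeta>. norm \<zeta> \<le> \<rho> \<longrightarrow> x + \<zeta> *s w \<in> S"
      using room by blast
    have "continuous_on (ball y \<delta> \<times> cbox 0 1) (\<lambda>(x, t). F (x + e \<rho> t *s w) / e \<rho> t)"
      using shift[OF contF *(2,3)] e0[OF *(2)]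
      by (auto simp: split_beta intro!: continuous_intros cont_e)
    then have "continuous_on (ball y \<delta>) (\<lambda>x. integral (cbox 0 1) (\<lambda>t. F (x + e \<rho> t *s w) / e \<rho> t))"
      by (rule integral_continuous_on_param)
    moreover have "integral (cbox 0 1) (\<lambda>t. F (x + e \<rho> t *s w) / e \<rho> t) = D x w" if "x \<in> ball y \<delta>" for x
      by (rule integral_unique[OF rep[OF *(2) bspec[OF *(3) that]]])
    ultimately have "continuous_on (ball y \<delta>) (\<lambda>x. D x w)"
      by (rule continuous_on_eq)
    then show "isCont (\<lambda>x. D x w) y"
      using *(1) by (simp add: continuous_on_eq_continuous_at)
  qed
  obtain \<delta> \<rho> where *: "\<delta> > 0" "\<rho> > 0" "\<forall>x\<in>ball x0 \<delta>. \<forall>\<zeta>. norm \<zeta> \<le> \<rho> \<longrightarrow> x + \<zeta> *s v \<in> S"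
    using room[OF x0] by blast
  have inS: "x + e \<rho> t *s v \<in> S" if "x \<in> ball x0 \<delta>" for x t
    using *(2,3) that by (simp add: norm_e)
  \<comment> \<open>\<open>leibniz_rule\<close> expects the derivative of the integrand as a
    continuous family of bounded linear maps.\<close>
  define fx where "fx x t = Blinfun (\<lambda>w. D (x + e \<rho> t *s v) w / e \<rho> t)" for x t
  have fx: "blinfun_apply (fx x t) = (\<lambda>w. D (x + e \<rho> t *s v) w / e \<rho> t)" if "x \<in> ball x0 \<delta>" for x t
  proof -
    have "bounded_linear (\<lambda>w. D (x + e \<rho> t *s v) w / e \<rho> t)"
      using has_derivative_bounded_linear[OF der[OF inS[OF that]]]
      by (rule bounded_linear_compose[OF bounded_linear_divide])
    then show ?thesis unfolding fx_def by (rule bounded_linear_Blinfun_apply)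
  qed
  have cont_fx: "continuous_on (ball x0 \<delta> \<times> cbox 0 1) (\<lambda>(x, t). fx x t)"
    unfolding split_beta
  proof (rule continuous_on_blinfun_componentwise)
    fix i :: "complex ^ 'n"
    have "continuous_on (ball x0 \<delta> \<times> cbox 0 1) (\<lambda>p. D (fst p + e \<rho> (snd p) *s v) i / e \<rho> (snd p))"
      using shift[OF contD[of i] *(2,3)] e0[OF *(2)]
      by (auto simp: split_beta intro!: continuous_intros cont_e)
    then show "continuous_on (ball x0 \<delta> \<times> cbox 0 1) (\<lambda>p. blinfun_apply (fx (fst p) (snd p)) i)"
      by (rule continuous_on_eq) (auto simp: fx)
  qed
  have "((\<lambda>x. integral (cbox 0 1) (\<lambda>t. F (x + e \<rho> t *s v) / e \<rho> t)) has_derivative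
      blinfun_apply (integral (cbox 0 1) (fx x0))) (at x0 within ball x0 \<delta>)"
  proof (rule leibniz_rule)
    fix x t assume x: "x \<in> ball x0 \<delta>" 
    have "((\<lambda>x. x + e \<rho> t *s v) has_derivative (\<lambda>h. h)) (at x)"
      by (auto intro!: derivative_eq_intros)
    from has_derivative_compose[OF this der[OF inS[OF x]]]
    have "((\<lambda>x. F (x + e \<rho> t *s v) / e \<rho> t) has_derivative (\<lambda>w. D (x + e \<rho> t *s v) w / e \<rho> t)) (at x)"
      by (rule bounded_linear.has_derivative[OF bounded_linear_divide])
    then show "((\<lambda>x. F (x + e \<rho> t *s v) / e \<rho> t) has_derivative blinfun_apply (fx x t)) (at x within ball x0 \<delta>)"
      unfolding fx[OF x] by (rule has_derivative_at_withinI)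
  next
    fix x assume "x \<in> ball x0 \<delta>"
    then show "(\<lambda>t. F (x + e \<rho> t *s v) / e \<rho> t) integrable_on cbox 0 1"
      using has_integral_integrable[OF rep[OF *(2) bspec[OF *(3)]]] by blast
  qed (use cont_fx *(1) in auto)
  then have "((\<lambda>x. D x v) has_derivative blinfun_apply (integral (cbox 0 1) (fx x0))) (at x0 within ball x0 \<delta>)"
  proof (rule has_derivative_transform[rotated 2])
    show "D x v = integral (cbox 0 1) (\<lambda>t. F (x + e \<rho> t *s v) / e \<rho> t)" if "x \<in> ball x0 \<delta>" for x
      using integral_unique[OF rep[OF *(2) bspec[OF *(3) that]]] by (rule sym)
  qed (use *(1) in auto)
  then have "((\<lambda>x. D x v) has_derivative blinfun_apply (integral (cbox 0 1) (fx x0))) (at x0)"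
    using *(1) at_within_open[of x0 "ball x0 \<delta>"] by simp
  moreover have "blinfun_apply (integral (cbox 0 1) (fx x0)) (c *s w) = c * blinfun_apply (integral (cbox 0 1) (fx x0)) w" for c w
  proof -
    have "continuous_on (cbox 0 1) (fx x0)"
      using continuous_on_compose2[OF cont_fx, of "cbox 0 1" "\<lambda>t. (x0, t)"] *(1)
      by (simp add: continuous_on_Pair image_subset_iff)
    then have int: "fx x0 integrable_on cbox 0 1" by (rule integrable_continuous)
    have "blinfun_apply (fx x0 t) (c *s w) = c * blinfun_apply (fx x0 t) w" for t
      using *(1) lin[OF inS] by (simp add: fx)
    then show ?thesis unfolding blinfun_apply_integral[OF int] by simp
  qed
  ultimately show ?thesis by blast
qed

text \<open>Reduces to the scalar case coordinate by coordinate. Closure under directional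
  derivatives is what makes induction on the order of differentiability possible.\<close>

lemma holomorphic_map_on_derivative:
  fixes f :: "complex ^ 'n::finite \<Rightarrow> complex ^ 'n"
  assumes "open S" "holomorphic_map_on S f"
  shows "holomorphic_map_on S (\<lambda>x. frechet_derivative f (at x) v)"
proof -
  obtain D where D: "\<And>x. x \<in> S \<Longrightarrow> (f has_derivative D x) (at x)"
    "\<And>x c v. x \<in> S \<Longrightarrow> D x (c *s v) = c *s D x v"
    using assms(2) unfolding holomorphic_map_on_def by metis
  have D_eq: "D x = frechet_derivative f (at x)" if "x \<in> S" for x
    using D(1)[OF that] by (rule frechet_derivative_at)
  show ?thesis
    unfolding holomorphic_map_on_def
  proof
    fix x assume x: "x \<in> S"
    have "\<exists>D'. ((\<lambda>x. D x v $ i) has_derivative D') (at x) \<and> (\<forall>c w. D' (c *s w) = c * D' w)" for i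
      by (rule directional_derivative_differentiable[OF assms(1), where F = "\<lambda>x. f x $ i" and D = "\<lambda>x w. D x w $ i"])
         (use x D in \<open>auto intro: bounded_linear.has_derivative[OF bounded_linear_vec_nth]\<close>)
    then obtain D' where D': "\<And>i. ((\<lambda>x. D x v $ i) has_derivative D' i) (at x)"
      "\<And>i c w. D' i (c *s w) = c * D' i w" by metis
    have "((\<lambda>x. \<chi> i. D x v $ i) has_derivative (\<lambda>w. \<chi> i. D' i w)) (at x)"
      using D'(1) by (rule has_derivative_vec_lambda)
    then have "((\<lambda>x. D x v) has_derivative (\<lambda>w. \<chi> i. D' i w)) (at x)" by simp
    then have "((\<lambda>x. frechet_derivative f (at x) v) has_derivative (\<lambda>w. \<chi> i. D' i w)) (at x)"
      by (rule has_derivative_transform_within_open[OF _ assms(1) x]) (simp add: D_eq)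
    moreover have "(\<chi> i. D' i (c *s w)) = c *s (\<chi> i. D' i w)" for c w
      by (simp add: vec_eq_iff D'(2))
    ultimately show "\<exists>D. ((\<lambda>x. frechet_derivative f (at x) v) has_derivative D) (at x) \<and>
        (\<forall>c v. D (c *s v) = c *s D v)" by blast
  qed
qed

lemma holomorphic_map_on_imp_has_derivative:
  assumes "holomorphic_map_on S f" "x \<in> S"
  shows "(f has_derivative frechet_derivative f (at x)) (at x)"
    and "frechet_derivative f (at x) (c *s v) = c *s frechet_derivative f (at x) v"
proof -
  obtain D where "(f has_derivative D) (at x)" "\<And>c v. D (c *s v) = c *s D v"
    using assms unfolding holomorphic_map_on_def by blast
  then show "(f has_derivative frechet_derivative f (at x)) (at x)"
    "frechet_derivative f (at x) (c *s v) = c *s frechet_derivative f (at x) v"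
    using frechet_derivative_at by metis+
qed

lemma holomorphic_map_on_imp_continuous_on:
  "holomorphic_map_on S f \<Longrightarrow> continuous_on S f"
  by (meson continuous_at_imp_continuous_on has_derivative_continuous
      holomorphic_map_on_imp_has_derivative(1))

section \<open>Smoothness of holomorphic maps\<close>

lemma Ck_on_cong:
  assumes "Ck_on k S f" "open S" "\<And>x. x \<in> S \<Longrightarrow> f x = g x"
  shows "Ck_on k S g"
  using assms(1,3)
proof (induction k arbitrary: f g)
  case 0
  then show ?case by (metis Ck_on.simps(1) continuous_on_cong)
next
  case (Suc k)
  have eq: "frechet_derivative f (at x) = frechet_derivative g (at x)" if "x \<in> S" for x
    using Suc.prems that \<open>open S\<close> by (intro frechet_derivative_transform_within_open) auto
  have "g differentiable at x" if "x \<in> S" for x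
  proof -
    have "(f has_derivative frechet_derivative f (at x)) (at x)"
      using Suc.prems that by (simp add: frechet_derivative_works)
    then have "(g has_derivative frechet_derivative f (at x)) (at x)"
      by (rule has_derivative_transform_within_open[OF _ \<open>open S\<close> that]) (simp add: Suc.prems)
    then show ?thesis by (auto simp: differentiable_def)
  qed
  moreover have "Ck_on k S (\<lambda>x. frechet_derivative g (at x) v)" for v
  proof (rule Suc.IH)
    show "Ck_on k S (\<lambda>x. frechet_derivative f (at x) v)" using Suc.prems(1) by simp
  qed (simp add: eq)
  ultimately show ?case by simp
qed

lemma Ck_on_subset: "Ck_on k S f \<Longrightarrow> T \<subseteq> S \<Longrightarrow> Ck_on k T f"
  by (induction k arbitrary: f) (auto intro: continuous_on_subset)

lemma smooth_on_subset: "smooth_on S f \<Longrightarrow> T \<subseteq> S \<Longrightarrow> smooth_on T f"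
  by (auto simp: smooth_on_def intro: Ck_on_subset)

text \<open>One statement for two uses: real charts, with \<open>l = cvec\<close> and
  \<open>r = re_vec\<close>, and curves, with \<open>l\<close> parametrizing a real line. The
  derivative in direction \<open>v\<close> has the same shape with \<open>f\<close> replaced by its
  derivative along \<open>l v\<close>, which drives the induction.\<close>

lemma smooth_on_holomorphic_between_affine:
  fixes f :: "complex ^ 'n::finite \<Rightarrow> complex ^ 'n"
    and l :: "'a::real_normed_vector \<Rightarrow> complex ^ 'n" and r :: "complex ^ 'n \<Rightarrow> 'b::real_normed_vector"
  assumes "open S" "holomorphic_map_on S f" "bounded_linear l" "bounded_linear r"
    and "open U" "\<And>x. x \<in> U \<Longrightarrow> a + l x \<in> S"
  shows "smooth_on U (\<lambda>x. r (f (a + l x)))"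
  unfolding smooth_on_def
proof
  fix k
  show "Ck_on k U (\<lambda>x. r (f (a + l x)))"
    using assms(2)
  proof (induction k arbitrary: f)
    case 0
    have "continuous_on U (\<lambda>x. f (a + l x))"
      by (rule continuous_on_compose2[OF holomorphic_map_on_imp_continuous_on[OF 0]])
         (use assms(6) in \<open>auto intro!: continuous_intros bounded_linear.continuous_on[OF assms(3)]\<close>)
    then show ?case by (simp add: bounded_linear.continuous_on[OF assms(4)])
  next
    case (Suc k)
    have der: "((\<lambda>x. r (f (a + l x))) has_derivative (\<lambda>v. r (frechet_derivative f (at (a + l x)) (l v)))) (at x)"
      if "x \<in> U" for x
    proof -
      have "((\<lambda>x. a + l x) has_derivative l) (at x)"
        by (auto intro!: derivative_eq_intros bounded_linear_imp_has_derivative assms)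
      from has_derivative_compose[OF this holomorphic_map_on_imp_has_derivative(1)[OF Suc.prems assms(6)[OF that]]]
      show ?thesis by (rule bounded_linear.has_derivative[OF assms(4)])
    qed
    have "Ck_on k U (\<lambda>x. frechet_derivative (\<lambda>x. r (f (a + l x))) (at x) v)" for v
    proof (rule Ck_on_cong[OF Suc.IH[OF holomorphic_map_on_derivative[OF assms(1) Suc.prems, of "l v"]] \<open>open U\<close>])
      fix x assume "x \<in> U"
      show "r (frechet_derivative f (at (a + l x)) (l v)) = frechet_derivative (\<lambda>x. r (f (a + l x))) (at x) v"
        by (rule fun_cong[OF frechet_derivative_at[OF der[OF \<open>x \<in> U\<close>]]])
    qed
    then show ?case using der by (auto simp: differentiable_def)
  qed
qed

section \<open>Real points of conjugation invariant complex submanifolds\<close>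

definition cvec :: "real ^ 'n \<Rightarrow> complex ^ 'n" where "cvec x = (\<chi> i. of_real (x $ i))"
definition re_vec :: "complex ^ 'n \<Rightarrow> real ^ 'n" where "re_vec z = (\<chi> i. Re (z $ i))"
definition im_vec :: "complex ^ 'n \<Rightarrow> real ^ 'n" where "im_vec z = (\<chi> i. Im (z $ i))"
definition cnj_vec :: "complex ^ 'n \<Rightarrow> complex ^ 'n" where "cnj_vec z = (\<chi> i. cnj (z $ i))"

lemmas cvec_defs = cvec_def re_vec_def im_vec_def cnj_vec_def

lemma vec_re_im_simps [simp]:
  "re_vec (cvec x) = x" "im_vec (cvec x) = 0" "cnj_vec (cvec x) = cvec x" "cnj_vec (cnj_vec z) = z"
  "re_vec (\<i> *s z) = - im_vec z" "im_vec (\<i> *s z) = re_vec z"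
  "re_vec (u + v) = re_vec u + re_vec v" "im_vec (u + v) = im_vec u + im_vec v"
  "cnj_vec (u + v) = cnj_vec u + cnj_vec v" "cnj_vec (u - v) = cnj_vec u - cnj_vec v"
  "cvec (x + y) = cvec x + cvec y" "cvec (x - y) = cvec x - cvec y"
  "cnj_vec (c *s z) = cnj c *s cnj_vec z" "cvec 0 = 0" "cnj_vec 0 = 0"
  "re_vec (cnj_vec z) = re_vec z" "im_vec (cnj_vec z) = - im_vec z"
  "re_vec 0 = 0" "im_vec 0 = 0"
  "cvec x = cvec y \<longleftrightarrow> x = y"
  by (simp_all add: cvec_defs vec_eq_iff)

lemma vec_re_im_eq: "cvec (re_vec z) + \<i> *s cvec (im_vec z) = z"
  by (simp add: cvec_defs vec_eq_iff complex_eq_iff)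

lemma cnj_vec_fixed_iff: "cnj_vec z = z \<longleftrightarrow> cvec (re_vec z) = z"
  by (simp add: cvec_defs vec_eq_iff complex_eq_iff)

lemma scaleR_vec_complex: "r *\<^sub>R v = complex_of_real r *s v"
  by (simp add: vec_eq_iff scaleR_conv_of_real[where 'a = complex])

lemma bounded_linear_vec_re_im:
  "bounded_linear (cvec :: real ^ 'n::finite \<Rightarrow> _)"
  "bounded_linear (re_vec :: complex ^ 'n::finite \<Rightarrow> _)"
  "bounded_linear (im_vec :: complex ^ 'n::finite \<Rightarrow> _)"
  "bounded_linear (cnj_vec :: complex ^ 'n::finite \<Rightarrow> _)"
  unfolding linear_conv_bounded_linear[symmetric]
  by (rule linearI; simp add: cvec_defs vec_eq_iff scaleR_conv_of_real[where 'a = complex])+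

lemma continuous_on_vec_re_im:
  "continuous_on S (cvec :: real ^ 'n::finite \<Rightarrow> _)"
  "continuous_on A (cnj_vec :: complex ^ 'n::finite \<Rightarrow> _)"
  by (auto intro: linear_continuous_on bounded_linear_vec_re_im)

lemma vec_subspace_imp_subspace:
  fixes W :: "(complex ^ 'n::finite) set"
  shows "vec.subspace W \<Longrightarrow> subspace W"
  by (simp add: subspace_def vec.subspace_def scaleR_vec_complex)

section \<open>Tangent vectors read in a chart\<close>

lemma vector_derivative_in_subspace:
  fixes W :: "'a::euclidean_space set"
  assumes "(g has_vector_derivative v) (at 0)" "subspace W" "eventually (\<lambda>t. g t - g 0 \<in> W) (at 0)"
  shows "v \<in> W"
proof -
  have "((\<lambda>t. norm (g (0 + t) - g 0 - t *\<^sub>R v) / norm t) \<longlongrightarrow> 0) (at 0)"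
    using assms(1) by (simp add: has_vector_derivative_def has_derivative_at)
  moreover have "norm (g (0 + t) - g 0 - t *\<^sub>R v) / norm t = norm ((g t - g 0) /\<^sub>R t - v)" if "t \<noteq> 0" for t
  proof -
    have "(g t - g 0) /\<^sub>R t - v = (g t - g 0 - t *\<^sub>R v) /\<^sub>R t"
      using that by (simp add: scaleR_diff_right)
    then show ?thesis by (simp add: divide_inverse mult.commute)
  qed
  ultimately have "((\<lambda>t. norm ((g t - g 0) /\<^sub>R t - v)) \<longlongrightarrow> 0) (at 0)"
    by (metis (no_types, lifting) LIM_cong)
  then have "((\<lambda>t. (g t - g 0) /\<^sub>R t) \<longlongrightarrow> v) (at 0)"
    by (simp add: LIM_zero_iff tendsto_norm_zero_iff)
  moreover have "eventually (\<lambda>t. (g t - g 0) /\<^sub>R t \<in> W) (at 0)"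
    using assms(3) by eventually_elim (simp add: assms(2) subspace_mul)
  ultimately show ?thesis
    by (intro Lim_in_closed_set[OF closed_subspace[OF assms(2)] _ trivial_limit_at])
qed

lemma biholomorphic_derivatives_inverse:
  assumes "open U" "open V" "homeomorphism U V \<phi> \<psi>" "holomorphic_map_on U \<phi>" "holomorphic_map_on V \<psi>"
    and "z \<in> U"
  shows "frechet_derivative \<psi> (at (\<phi> z)) (frechet_derivative \<phi> (at z) v) = v"
    and "frechet_derivative \<phi> (at z) (frechet_derivative \<psi> (at (\<phi> z)) w) = w"
proof -
  have hom: "\<phi> z \<in> V" "\<And>x. x \<in> U \<Longrightarrow> \<psi> (\<phi> x) = x" "\<And>y. y \<in> V \<Longrightarrow> \<phi> (\<psi> y) = y"
    using assms(3,6) by (auto simp: homeomorphism_def)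
  note d\<phi> = holomorphic_map_on_imp_has_derivative(1)[OF assms(4,6)]
  note d\<psi> = holomorphic_map_on_imp_has_derivative(1)[OF assms(5) hom(1)]
  have "((\<lambda>x. x) has_derivative (\<lambda>v. frechet_derivative \<psi> (at (\<phi> z)) (frechet_derivative \<phi> (at z) v))) (at z)"
    by (rule has_derivative_transform_within_open[OF has_derivative_compose[OF d\<phi> d\<psi>] assms(1,6)]) (rule hom(2))
  from has_derivative_unique[OF this has_derivative_ident]
  show "frechet_derivative \<psi> (at (\<phi> z)) (frechet_derivative \<phi> (at z) v) = v" by meson
  have d\<phi>': "(\<phi> has_derivative frechet_derivative \<phi> (at z)) (at (\<psi> (\<phi> z)))"
    using d\<phi> hom(2) assms(6) by simp
  have "((\<lambda>x. x) has_derivative (\<lambda>v. frechet_derivative \<phi> (at z) (frechet_derivative \<psi> (at (\<phi> z)) v))) (at (\<phi> z))"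
    by (rule has_derivative_transform_within_open[OF has_derivative_compose[OF d\<psi> d\<phi>'] assms(2) hom(1)]) (rule hom(3))
  from has_derivative_unique[OF this has_derivative_ident]
  show "frechet_derivative \<phi> (at z) (frechet_derivative \<psi> (at (\<phi> z)) w) = w" by meson
qed

lemma vec_linear_frechet_derivative:
  assumes "holomorphic_map_on S f" "x \<in> S"
  shows "Vector_Spaces.linear (*s) (*s) (frechet_derivative f (at x))"
proof -
  interpret bounded_linear "frechet_derivative f (at x)"
    using holomorphic_map_on_imp_has_derivative(1)[OF assms] by (rule has_derivative_bounded_linear)
  show ?thesis
    by unfold_locales (auto simp: add holomorphic_map_on_imp_has_derivative(2)[OF assms] vector_add_ldistrib vector_sadd_rdistrib vector_smult_assoc)
qed

lemma eventually_at_0_line_in_open: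
  fixes a v :: "'a::real_normed_vector"
  assumes "open S" "a \<in> S"
  shows "eventually (\<lambda>t::real. a + t *\<^sub>R v \<in> S) (at 0)"
proof -
  have "((\<lambda>t. a + t *\<^sub>R v) \<longlongrightarrow> a + 0 *\<^sub>R v) (at 0)" by (intro tendsto_intros)
  with assms show ?thesis by (simp add: topological_tendstoD)
qed

text \<open>The tangent space as the chart sees it. In contrast to \<open>tangent_space\<close>,
  which is defined by curves, it is visibly a complex subspace in a biholomorphic chart.\<close>

definition model_space :: "(complex ^ 'n::finite \<Rightarrow> complex ^ 'n) \<Rightarrow> complex ^ 'n \<Rightarrow> (complex ^ 'n) set \<Rightarrow> (complex ^ 'n) set" where
  "model_space \<phi> z W = {v. frechet_derivative \<phi> (at z) v \<in> W}"

lemma model_space: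
  assumes "open U" "open V" "homeomorphism U V \<phi> \<psi>" "holomorphic_map_on U \<phi>" "holomorphic_map_on V \<psi>"
    and "z \<in> U" "vec.subspace W"
  shows "model_space \<phi> z W = frechet_derivative \<psi> (at (\<phi> z)) ` W"
    and "vec.subspace (model_space \<phi> z W)" "vec.dim (model_space \<phi> z W) = vec.dim W"
proof -
  note inv = biholomorphic_derivatives_inverse[OF assms(1-6)]
  show eq: "model_space \<phi> z W = frechet_derivative \<psi> (at (\<phi> z)) ` W"
    unfolding model_space_def using inv by (auto simp: image_iff) metis
  have "\<phi> z \<in> V" using assms(3,6) by (auto simp: homeomorphism_def)
  then have lin: "Vector_Spaces.linear (*s) (*s) (frechet_derivative \<psi> (at (\<phi> z)))"
    using assms(5) vec_linear_frechet_derivative by blast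
  show "vec.subspace (model_space \<phi> z W)"
    unfolding eq using lin assms(7) by (rule vec.linear_subspace_image)
  have "inj (frechet_derivative \<psi> (at (\<phi> z)))" using inv(2) by (rule inj_on_inverseI)
  then show "vec.dim (model_space \<phi> z W) = vec.dim W"
    unfolding eq using lin by (intro vec.dim_image_eq) (auto intro: inj_on_subset)
qed

text \<open>The curve need only be differentiable at 0 and stay in \<open>M\<close> near 0, so
  conjugates of curves and real curves viewed in complex space are covered without discussing their
  smoothness.\<close>

lemma curve_derivative_in_model_space:
  assumes "open U" "open V" "homeomorphism U V \<phi> \<psi>" "holomorphic_map_on U \<phi>"
    and "vec.subspace W" "\<phi> ` (M \<inter> U) = V \<inter> W" "\<gamma> 0 \<in> U"
    and "(\<gamma> has_vector_derivative v) (at (0::real))" "\<gamma> 0 \<in> M" "eventually (\<lambda>t. \<gamma> t \<in> M) (at 0)"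
  shows "v \<in> model_space \<phi> (\<gamma> 0) W"
proof -
  have "isCont \<gamma> 0" using assms(8) by (rule has_vector_derivative_continuous)
  then have "eventually (\<lambda>t. \<gamma> t \<in> U) (at 0)"
    using assms(1,7) by (simp add: isCont_def topological_tendstoD)
  with assms(10) have ev: "eventually (\<lambda>t. \<phi> (\<gamma> t) - \<phi> (\<gamma> 0) \<in> W) (at 0)"
  proof eventually_elim
    case (elim t)
    then have "\<phi> (\<gamma> t) \<in> W" "\<phi> (\<gamma> 0) \<in> W" using assms(6,7,9) by blast+
    then show ?case using assms(5) by (simp add: vec.subspace_diff)
  qed
  have "((\<lambda>t. \<phi> (\<gamma> t)) has_derivative (\<lambda>h. frechet_derivative \<phi> (at (\<gamma> 0)) (h *\<^sub>R v))) (at 0)"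
    using has_derivative_compose[OF assms(8)[unfolded has_vector_derivative_def]
       holomorphic_map_on_imp_has_derivative(1)[OF assms(4,7)]] .
  then have "((\<lambda>t. \<phi> (\<gamma> t)) has_vector_derivative frechet_derivative \<phi> (at (\<gamma> 0)) v) (at 0)"
    unfolding has_vector_derivative_def scaleR_vec_complex
      holomorphic_map_on_imp_has_derivative(2)[OF assms(4,7)] .
  from vector_derivative_in_subspace[OF this vec_subspace_imp_subspace[OF assms(5)] ev]
  show ?thesis by (simp add: model_space_def)
qed

text \<open>The straight line through \<open>\<phi> z\<close> inside \<open>W\<close> is pulled back
  by \<open>\<psi>\<close>. The map \<open>r\<close> is the identity for curves in \<open>M\<close>
  and \<open>re_vec\<close> for curves of real points; that the line stays in \<open>V\<close> later
  shows such a curve to be real.\<close>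

lemma curve_through_model_space:
  assumes "open U" "open V" "homeomorphism U V \<phi> \<psi>" "holomorphic_map_on U \<phi>" "holomorphic_map_on V \<psi>"
    and "z \<in> U" "vec.subspace W" "\<phi> ` (M \<inter> U) = V \<inter> W" "z \<in> M" "v \<in> model_space \<phi> z W"
    and "bounded_linear r"
  defines "\<gamma> \<equiv> \<lambda>t::real. \<psi> (\<phi> z + t *\<^sub>R frechet_derivative \<phi> (at z) v)"
  shows "\<exists>e>0. smooth_on {-e<..<e} (\<lambda>t. r (\<gamma> t)) \<and> \<gamma> ` {-e<..<e} \<subseteq> M \<and>
     (\<forall>t\<in>{-e<..<e}. \<phi> z + t *\<^sub>R frechet_derivative \<phi> (at z) v \<in> V)"
    and "\<gamma> 0 = z" "(\<gamma> has_vector_derivative v) (at 0)"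
proof -
  have hom: "\<phi> z \<in> V" "\<And>x. x \<in> U \<Longrightarrow> \<psi> (\<phi> x) = x" "\<And>y. y \<in> V \<Longrightarrow> \<phi> (\<psi> y) = y" "\<And>y. y \<in> V \<Longrightarrow> \<psi> y \<in> U"
    using assms(3,6) by (auto simp: homeomorphism_def)
  have W: "\<phi> z \<in> W" "frechet_derivative \<phi> (at z) v \<in> W"
    using assms(6,8,9,10) by (auto simp: model_space_def)
  have "eventually (\<lambda>t::real. \<phi> z + t *\<^sub>R frechet_derivative \<phi> (at z) v \<in> V) (at 0)"
    using assms(2) hom(1) by (rule eventually_at_0_line_in_open)
  then obtain e where e: "e > 0" "\<And>t::real. t \<noteq> 0 \<Longrightarrow> \<bar>t\<bar> < e \<Longrightarrow> \<phi> z + t *\<^sub>R frechet_derivative \<phi> (at z) v \<in> V"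
    by (auto simp: eventually_at)
  then have inV: "\<phi> z + t *\<^sub>R frechet_derivative \<phi> (at z) v \<in> V" if "t \<in> {-e<..<e}" for t
    using that hom(1) by (cases "t = 0") auto
  have "smooth_on {-e<..<e} (\<lambda>t. r (\<gamma> t))"
    unfolding \<gamma>_def
    by (rule smooth_on_holomorphic_between_affine[OF assms(2,5) bounded_linear_scaleR_left assms(11)])
       (use inV in auto)
  moreover have "\<gamma> t \<in> M \<inter> U" if "t \<in> {-e<..<e}" for t
  proof -
    have "\<phi> z + t *\<^sub>R frechet_derivative \<phi> (at z) v \<in> W"
      using W vec_subspace_imp_subspace[OF assms(7)] by (simp add: subspace_add subspace_mul)
    then have "\<phi> z + t *\<^sub>R frechet_derivative \<phi> (at z) v \<in> \<phi> ` (M \<inter> U)"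
      using inV[OF that] assms(8) by blast
    then show ?thesis unfolding \<gamma>_def using hom(2) by force
  qed
  ultimately show "\<exists>e>0. smooth_on {-e<..<e} (\<lambda>t. r (\<gamma> t)) \<and> \<gamma> ` {-e<..<e} \<subseteq> M \<and>
     (\<forall>t\<in>{-e<..<e}. \<phi> z + t *\<^sub>R frechet_derivative \<phi> (at z) v \<in> V)"
    using e(1) inV by blast
  show "\<gamma> 0 = z" using hom(2) assms(6) by (simp add: \<gamma>_def)
  have "((\<lambda>t::real. \<phi> z + t *\<^sub>R frechet_derivative \<phi> (at z) v) has_derivative
      (\<lambda>t. t *\<^sub>R frechet_derivative \<phi> (at z) v)) (at 0)"
    by (auto intro!: derivative_eq_intros)
  from has_derivative_compose[OF this, of \<psi> "frechet_derivative \<psi> (at (\<phi> z))"]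
  have "(\<gamma> has_derivative (\<lambda>t. frechet_derivative \<psi> (at (\<phi> z)) (t *\<^sub>R frechet_derivative \<phi> (at z) v))) (at 0)"
    unfolding \<gamma>_def using holomorphic_map_on_imp_has_derivative(1)[OF assms(5) hom(1)] by simp
  then show "(\<gamma> has_vector_derivative v) (at 0)"
    unfolding has_vector_derivative_def scaleR_vec_complex
      holomorphic_map_on_imp_has_derivative(2)[OF assms(5) hom(1)]
      biholomorphic_derivatives_inverse(1)[OF assms(1-6)] .
qed

lemma tangent_space_eq_model_space:
  assumes "open U" "open V" "homeomorphism U V \<phi> \<psi>" "holomorphic_map_on U \<phi>" "holomorphic_map_on V \<psi>"
    and "z \<in> U" "vec.subspace W" "\<phi> ` (M \<inter> U) = V \<inter> W" "z \<in> M"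
  shows "tangent_space M z = model_space \<phi> z W"
proof (intro equalityI subsetI)
  fix v assume "v \<in> tangent_space M z"
  then obtain \<gamma> e where \<gamma>: "e > 0" "\<gamma> ` {-e<..<e} \<subseteq> M" "\<gamma> (0::real) = z" "(\<gamma> has_vector_derivative v) (at 0)"
    unfolding tangent_space_def by blast
  have "eventually (\<lambda>t. t \<in> {-e<..<e}) (at (0::real))"
    using \<gamma>(1) by (intro eventually_at_in_open') auto
  then have "eventually (\<lambda>t. \<gamma> t \<in> M) (at 0)"
    by eventually_elim (use \<gamma>(2) in blast)
  with curve_derivative_in_model_space[OF assms(1-4,7,8), of \<gamma> v] \<gamma> assms(6,9)
  show "v \<in> model_space \<phi> z W" by simp
next
  fix v assume "v \<in> model_space \<phi> z W"
  with curve_through_model_space[OF assms(1-9) _ bounded_linear_ident, of v]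
  show "v \<in> tangent_space M z" unfolding tangent_space_def by blast
qed

lemma open_cnj_vec_vimage: "open S \<Longrightarrow> open (cnj_vec -` S :: (complex ^ 'n::finite) set)"
  by (rule continuous_open_vimage) (use continuous_on_vec_re_im(2)[of UNIV] in \<open>auto simp: continuous_on_eq_continuous_at\<close>)

text \<open>Conjugating a curve in \<open>M\<close> through the real point \<open>z\<close> gives
  another curve in \<open>M\<close> through \<open>z\<close>, with conjugate velocity.\<close>

lemma model_space_cnj:
  assumes "open U" "open V" "homeomorphism U V \<phi> \<psi>" "holomorphic_map_on U \<phi>" "holomorphic_map_on V \<psi>"
    and "z \<in> U" "vec.subspace W" "\<phi> ` (M \<inter> U) = V \<inter> W" "z \<in> M"
    and "cnj_vec ` M \<subseteq> M" "cnj_vec z = z" "v \<in> model_space \<phi> z W"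
  shows "cnj_vec v \<in> model_space \<phi> z W"
proof -
  define \<gamma> where "\<gamma> t = \<psi> (\<phi> z + t *\<^sub>R frechet_derivative \<phi> (at z) v)" for t :: real
  note c = curve_through_model_space[OF assms(1-9,12) bounded_linear_ident, folded \<gamma>_def]
  have \<gamma>0: "\<gamma> 0 = z" using c(2) .
  obtain e where e: "e > 0" "\<gamma> ` {-e<..<e} \<subseteq> M" using c(1) by blast
  have "eventually (\<lambda>t. t \<in> {-e<..<e}) (at (0::real))"
    using e(1) by (intro eventually_at_in_open') auto
  then have "eventually (\<lambda>t. cnj_vec (\<gamma> t) \<in> M) (at 0)"
    by eventually_elim (use e(2) assms(10) in blast)
  moreover have "((\<lambda>t. cnj_vec (\<gamma> t)) has_vector_derivative cnj_vec v) (at 0)"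
    using c(3) by (rule bounded_linear.has_vector_derivative[OF bounded_linear_vec_re_im(4)])
  ultimately show ?thesis
    using curve_derivative_in_model_space[OF assms(1-4,7,8), of "\<lambda>t. cnj_vec (\<gamma> t)" "cnj_vec v"]
      \<gamma>0 assms(6,9,11) by simp
qed

section \<open>Charts compatible with conjugation\<close>

lemma homeomorphism_restrict_open:
  assumes "homeomorphism U V f g" "V' \<subseteq> V" "open U" "open V'"
  shows "homeomorphism (U \<inter> f -` V') V' f g" "open (U \<inter> f -` V')"
proof -
  show "homeomorphism (U \<inter> f -` V') V' f g"
    using assms(1,2) by (intro homeomorphism_of_subsets[OF assms(1)]) (auto simp: homeomorphism_def)
  have "continuous_on U f" using assms(1) by (simp add: homeomorphism_def)
  then show "open (U \<inter> f -` V')" using assms(3,4) by (simp add: continuous_on_open_vimage Int_commute)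
qed

lemma homeomorphism_open_image:
  assumes "homeomorphism U V f g" "open V" "open U'" "U' \<subseteq> U"
  shows "open (f ` U')"
proof -
  have "f ` U' = V \<inter> g -` U'"
    using assms(1,4) unfolding homeomorphism_def by (auto simp: image_iff)
  moreover have "continuous_on V g" using assms(1) by (simp add: homeomorphism_def)
  ultimately show ?thesis using assms(2,3) by (simp add: continuous_on_open_vimage Int_commute)
qed

text \<open>The real inverse function theorem applies because holomorphic maps are continuously
  differentiable. The local inverse is holomorphic since the inverse of a complex linear bijection
  is complex linear.\<close>

lemma holomorphic_inverse_function_theorem:
  fixes f :: "complex ^ 'n::finite \<Rightarrow> complex ^ 'n"
  assumes "open S" "holomorphic_map_on S f" "x0 \<in> S" "(f has_derivative (\<lambda>v. v)) (at x0)"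
  obtains U V g where "open U" "U \<subseteq> S" "x0 \<in> U" "open V" "homeomorphism U V f g" "holomorphic_map_on V g"
proof -
  note der = holomorphic_map_on_imp_has_derivative[OF assms(2)]
  define f' where "f' x = Blinfun (frechet_derivative f (at x))" for x
  have f': "blinfun_apply (f' x) = frechet_derivative f (at x)" if "x \<in> S" for x
    unfolding f'_def using has_derivative_bounded_linear[OF der(1)[OF that]]
    by (rule bounded_linear_Blinfun_apply)
  have "continuous_on S f'"
  proof (rule continuous_on_blinfun_componentwise)
    fix i :: "complex ^ 'n"
    have "continuous_on S (\<lambda>x. frechet_derivative f (at x) i)"
      by (intro holomorphic_map_on_imp_continuous_on holomorphic_map_on_derivative assms)
    then show "continuous_on S (\<lambda>x. blinfun_apply (f' x) i)"
      by (rule continuous_on_eq) (simp add: f')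
  qed
  moreover have "id_blinfun o\<^sub>L f' x0 = id_blinfun"
    by (intro blinfun_eqI) (simp add: f'[OF assms(3)] frechet_derivative_at[OF assms(4), symmetric])
  ultimately obtain U V g g' where *: "open U" "U \<subseteq> S" "x0 \<in> U" "open V" "homeomorphism U V f g"
    "\<And>y. y \<in> V \<Longrightarrow> (g has_derivative (g' y)) (at y)"
    "\<And>y. y \<in> V \<Longrightarrow> g' y = inv (blinfun_apply (f'(g y)))"
    "\<And>y. y \<in> V \<Longrightarrow> bij (blinfun_apply (f'(g y)))"
    using inverse_function_theorem[of S f f' x0 id_blinfun] assms(1,3) der(1) f' by metis
  have "holomorphic_map_on V g"
    unfolding holomorphic_map_on_def
  proof (intro ballI exI conjI allI)
    fix y c v assume y: "y \<in> V"
    show "(g has_derivative (g' y)) (at y)" using *(6)[OF y] .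
    let ?D = "blinfun_apply (f' (g y))"
    have gy: "g y \<in> S" using y *(2,5) by (auto simp: homeomorphism_def)
    have "?D (c *s inv ?D v) = c *s v"
      using der(2)[OF gy] *(8)[OF y] by (simp add: f'[OF gy, symmetric] bij_is_surj surj_f_inv_f)
    then have "inv ?D (c *s v) = c *s inv ?D v"
      using *(8)[OF y] by (metis bij_inv_eq_iff)
    then show "g' y (c *s v) = c *s g' y v" using *(7)[OF y] by simp
  qed
  with * that show ?thesis by blast
qed

lemma holomorphic_map_on_subset: "holomorphic_map_on S f \<Longrightarrow> T \<subseteq> S \<Longrightarrow> holomorphic_map_on T f"
  by (auto simp: holomorphic_map_on_def)

text \<open>The chart \<open>z \<mapsto> D\<psi> (\<phi> z - \<phi> p)\<close> has derivative the identity at the real point \<open>p\<close>; its average with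
  its complex conjugate commutes with conjugation and still maps \<open>M\<close> into the tangent space \<open>T\<close>, onto a
  neighbourhood of the origin by invariance of domain.\<close>

lemma cnj_invariant_submanifold_chart:
  fixes M :: "(complex ^ 'n::finite) set"
  assumes M: "complex_submanifold d M" and cnjM: "cnj_vec ` M \<subseteq> M" and p: "p \<in> M" "cnj_vec p = p"
  obtains T U V \<Phi> \<Psi> where "vec.subspace T" "vec.dim T = d" "cnj_vec ` T \<subseteq> T"
    "open U" "p \<in> U" "open V" "homeomorphism U V \<Phi> \<Psi>"
    "holomorphic_map_on U \<Phi>" "holomorphic_map_on V \<Psi>" "\<Phi> ` (M \<inter> U) = V \<inter> T"
    "\<Phi> p = 0" "(\<Phi> has_derivative (\<lambda>v. v)) (at p)"
    "\<And>z. z \<in> U \<Longrightarrow> cnj_vec z = z \<Longrightarrow> cnj_vec (\<Phi> z) = \<Phi> z"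
    "\<And>w. w \<in> V \<Longrightarrow> cnj_vec w = w \<Longrightarrow> cnj_vec (\<Psi> w) = \<Psi> w"
proof -
  obtain U0 V0 \<phi> \<psi> W where chart: "open U0" "open V0" "homeomorphism U0 V0 \<phi> \<psi>"
    "holomorphic_map_on U0 \<phi>" "holomorphic_map_on V0 \<psi>" "p \<in> U0" "vec.subspace W"
    "\<phi> ` (M \<inter> U0) = V0 \<inter> W" and dimW: "vec.dim W = d"
    using M p(1) unfolding complex_submanifold_def by metis
  define T where "T = model_space \<phi> p W"
  note T = model_space[OF chart(1-7), folded T_def]
  have cnjT: "cnj_vec v \<in> T" if "v \<in> T" for v
    using model_space_cnj[OF chart p(1) cnjM p(2)] that by (simp add: T_def)
  have subT: "subspace T" using T(2) by (rule vec_subspace_imp_subspace)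
  define B where "B = frechet_derivative \<psi> (at (\<phi> p))"
  have "\<phi> p \<in> V0" using chart(3,6) by (auto simp: homeomorphism_def)
  then have B: "bounded_linear B" "\<And>c v. B (c *s v) = c *s B v"
    unfolding B_def using holomorphic_map_on_imp_has_derivative[OF chart(5)] has_derivative_bounded_linear by blast+
  have TB: "T = B ` W" using T(1) by (simp add: B_def)
  \<comment> \<open>Intersecting with the conjugate domain lets the average \<open>\<Phi>\<close> be
    differentiated at every point of \<open>U1\<close>.\<close>
  define U1 where "U1 = U0 \<inter> cnj_vec -` U0"
  have U1: "open U1" "p \<in> U1" "U1 \<subseteq> U0" "\<And>z. z \<in> U1 \<Longrightarrow> cnj_vec z \<in> U1"
    using chart(1,6) open_cnj_vec_vimage p(2) by (auto simp: U1_def)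
  define \<Phi>0 where "\<Phi>0 z = B (\<phi> z - \<phi> p)" for z
  define \<Phi> where "\<Phi> z = (1/2) *\<^sub>R (\<Phi>0 z + cnj_vec (\<Phi>0 (cnj_vec z)))" for z
  have \<Phi>0p: "\<Phi>0 p = 0" using B(1) by (simp add: \<Phi>0_def linear_simps)
  have d\<Phi>0: "(\<Phi>0 has_derivative (\<lambda>v. B (frechet_derivative \<phi> (at z) v))) (at z)" if "z \<in> U0" for z
  proof -
    have "((\<lambda>z. \<phi> z - \<phi> p) has_derivative frechet_derivative \<phi> (at z)) (at z)"
      by (rule has_derivative_eq_rhs[OF has_derivative_diff[OF
            holomorphic_map_on_imp_has_derivative(1)[OF chart(4) that] has_derivative_const]]) simp
    then show ?thesis unfolding \<Phi>0_def by (rule bounded_linear.has_derivative[OF B(1)])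
  qed
  have d\<Phi>: "(\<Phi> has_derivative (\<lambda>v. (1/2) *\<^sub>R (B (frechet_derivative \<phi> (at z) v) +
        cnj_vec (B (frechet_derivative \<phi> (at (cnj_vec z)) (cnj_vec v)))))) (at z)" if "z \<in> U1" for z
  proof -
    have "(cnj_vec has_derivative cnj_vec) (at z)"
      using bounded_linear_vec_re_im(4) by (rule bounded_linear_imp_has_derivative)
    moreover have "cnj_vec z \<in> U0" using that by (simp add: U1_def)
    ultimately have "((\<lambda>z. cnj_vec (\<Phi>0 (cnj_vec z))) has_derivative
        (\<lambda>v. cnj_vec (B (frechet_derivative \<phi> (at (cnj_vec z)) (cnj_vec v))))) (at z)"
      by (rule bounded_linear.has_derivative[OF bounded_linear_vec_re_im(4) has_derivative_compose[OF _ d\<Phi>0]])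
    with d\<Phi>0[of z] that show ?thesis
      unfolding \<Phi>_def U1_def by (intro has_derivative_scaleR_right has_derivative_add) auto
  qed
  \<comment> \<open>Conjugating both argument and value is antilinear twice, hence preserves complex
    linearity of the derivative.\<close>
  have hol: "holomorphic_map_on U1 \<Phi>"
    unfolding holomorphic_map_on_def
  proof (intro ballI exI conjI allI)
    fix z c v assume z: "z \<in> U1"
    then have z': "z \<in> U0" "cnj_vec z \<in> U0" by (auto simp: U1_def)
    show "(\<Phi> has_derivative (\<lambda>v. (1/2) *\<^sub>R (B (frechet_derivative \<phi> (at z) v) +
        cnj_vec (B (frechet_derivative \<phi> (at (cnj_vec z)) (cnj_vec v)))))) (at z)"
      using z by (rule d\<Phi>)
    show "(1/2) *\<^sub>R (B (frechet_derivative \<phi> (at z) (c *s v)) + cnj_vec (B (frechet_derivative \<phi> (at (cnj_vec z)) (cnj_vec (c *s v)))))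
      = c *s ((1/2) *\<^sub>R (B (frechet_derivative \<phi> (at z) v) + cnj_vec (B (frechet_derivative \<phi> (at (cnj_vec z)) (cnj_vec v)))))"
      by (simp add: holomorphic_map_on_imp_has_derivative(2)[OF chart(4)] z' B(2) vec_eq_iff algebra_simps)
  qed
  have BA: "B (frechet_derivative \<phi> (at p) v) = v" for v
    unfolding B_def by (rule biholomorphic_derivatives_inverse(1)[OF chart(1-6)])
  have d\<Phi>p: "(\<Phi> has_derivative (\<lambda>v. v)) (at p)"
    using d\<Phi>[OF U1(2)] by (simp add: p(2) BA scaleR_2[symmetric] del: scaleR_half_double)
  have \<Phi>p: "\<Phi> p = 0" by (simp add: \<Phi>_def p(2) \<Phi>0p)
  have cnj\<Phi>: "cnj_vec (\<Phi> z) = \<Phi> (cnj_vec z)" for z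
    by (simp add: \<Phi>_def scaleR_vec_complex add.commute)
  have \<Phi>0T: "\<Phi>0 z \<in> T" if "z \<in> M" "z \<in> U0" for z
  proof -
    have "\<phi> z \<in> W" "\<phi> p \<in> W" using that p(1) chart(6,8) by blast+
    then have "\<phi> z - \<phi> p \<in> W" using chart(7) by (simp add: vec.subspace_diff)
    then show ?thesis unfolding TB \<Phi>0_def by blast
  qed
  have \<Phi>T: "\<Phi> z \<in> T" if "z \<in> M" "z \<in> U1" for z
  proof -
    have "\<Phi>0 z \<in> T" "cnj_vec (\<Phi>0 (cnj_vec z)) \<in> T"
      using \<Phi>0T cnjT cnjM that by (auto simp: U1_def)
    then show ?thesis unfolding \<Phi>_def using subT by (intro subspace_mul subspace_add)
  qed
  obtain U2 V2 \<Psi> where inv: "open U2" "U2 \<subseteq> U1" "p \<in> U2" "open V2" "homeomorphism U2 V2 \<Phi> \<Psi>" "holomorphic_map_on V2 \<Psi>"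
    using holomorphic_inverse_function_theorem[OF U1(1) hol U1(2) d\<Phi>p] by metis
  \<comment> \<open>The inverse function theorem returns a domain without symmetry. It is
    symmetrized again, so that injectivity of \<open>\<Phi>\<close> applies to a point together with
    its conjugate.\<close>
  define U3 where "U3 = U2 \<inter> cnj_vec -` U2"
  have U3: "open U3" "p \<in> U3" "U3 \<subseteq> U2" "\<And>z. z \<in> U3 \<Longrightarrow> cnj_vec z \<in> U2"
    using inv(1,3) open_cnj_vec_vimage p(2) by (auto simp: U3_def)
  have "U3 \<subseteq> U0" using U3(3) inv(2) U1(3) by blast
  have "openin (top_of_set T) (\<Phi> ` (M \<inter> U3))"
  proof -
    \<comment> \<open>Invariance of domain speaks of open subsets of subspaces, so
      \<open>\<Phi>\<close> on \<open>M\<close> is replaced by \<open>\<Phi> (\<psi> w)\<close> for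
      \<open>w\<close> in an open subset of \<open>W\<close>.\<close>
    let ?S = "\<phi> ` (M \<inter> U3)"
    have inj: "inj_on \<phi> U0" using homeomorphism_apply1[OF chart(3)] by (rule inj_on_inverseI)
    have "?S = \<phi> ` U3 \<inter> W"
    proof -
      have "?S = \<phi> ` ((M \<inter> U0) \<inter> U3)" using \<open>U3 \<subseteq> U0\<close> by (intro arg_cong[of _ _ "image \<phi>"]) blast
      also have "\<dots> = \<phi> ` (M \<inter> U0) \<inter> \<phi> ` U3"
        using \<open>U3 \<subseteq> U0\<close> by (intro inj_on_image_Int[OF inj]) auto
      also have "\<dots> = \<phi> ` U3 \<inter> W"
        using chart(8) \<open>U3 \<subseteq> U0\<close> chart(3) by (auto simp: homeomorphism_def)
      finally show ?thesis .
    qed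
    moreover have "open (\<phi> ` U3)"
      by (rule homeomorphism_open_image[OF chart(3,2) U3(1) \<open>U3 \<subseteq> U0\<close>])
    ultimately have ope: "openin (top_of_set W) ?S" by (simp add: openin_open_Int Int_commute)
    have \<psi>\<phi>: "\<psi> (\<phi> z) = z" if "z \<in> U0" for z using chart(3) that by (simp add: homeomorphism_def)
    have "?S \<subseteq> V0" using \<open>U3 \<subseteq> U0\<close> chart(3) by (auto simp: homeomorphism_def)
    then have c\<psi>: "continuous_on ?S \<psi>" using chart(3) by (metis continuous_on_subset homeomorphism_cont2)
    have "\<psi> ` ?S \<subseteq> U1" using \<open>U3 \<subseteq> U0\<close> U3(3) inv(2) by (auto simp: \<psi>\<phi> subset_iff)
    then have "continuous_on ?S (\<lambda>w. \<Phi> (\<psi> w))"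
      by (intro continuous_on_compose2[OF holomorphic_map_on_imp_continuous_on[OF hol] c\<psi>])
    moreover have "(\<lambda>w. \<Phi> (\<psi> w)) \<in> ?S \<rightarrow> T"
      using \<Phi>T \<open>U3 \<subseteq> U0\<close> U3(3) inv(2) by (auto simp: \<psi>\<phi> subset_iff)
    moreover have "inj_on (\<lambda>w. \<Phi> (\<psi> w)) ?S"
    proof (rule inj_onI)
      fix a b assume "a \<in> ?S" "b \<in> ?S" "\<Phi> (\<psi> a) = \<Phi> (\<psi> b)"
      then obtain x y where "a = \<phi> x" "b = \<phi> y" "x \<in> U3" "y \<in> U3" "\<Phi> x = \<Phi> y"
        using \<psi>\<phi> \<open>U3 \<subseteq> U0\<close> by (auto simp: subset_iff)
      then show "a = b" using homeomorphism_apply1[OF inv(5)] U3(3) by (metis subsetD)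
    qed
    moreover have "dim T \<le> dim W"
      unfolding TB using B(1) by (intro dim_image_le) (rule bounded_linear.linear)
    ultimately have "openin (top_of_set T) ((\<lambda>w. \<Phi> (\<psi> w)) ` ?S)"
      using invariance_of_domain_subspaces[OF ope vec_subspace_imp_subspace[OF chart(7)] subT] by blast
    moreover have "(\<lambda>w. \<Phi> (\<psi> w)) ` ?S = \<Phi> ` (M \<inter> U3)"
      unfolding image_image using \<psi>\<phi> \<open>U3 \<subseteq> U0\<close> by (intro image_cong) auto
    ultimately show ?thesis by simp
  qed
  then obtain O' where O': "open O'" "\<Phi> ` (M \<inter> U3) = T \<inter> O'"
    by (auto simp: openin_open)
  \<comment> \<open>Cutting with \<open>O'\<close> keeps only those points of \<open>T\<close> that
    are images of points of \<open>M\<close>.\<close>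
  define V where "V = \<Phi> ` U3 \<inter> O'"
  have "open (\<Phi> ` U3)" by (rule homeomorphism_open_image[OF inv(5,4) U3(1,3)])
  then have V: "open V" "V \<subseteq> V2"
    using O'(1) U3(3) inv(5) by (auto simp: V_def homeomorphism_def)
  define U where "U = U2 \<inter> \<Phi> -` V"
  note hom = homeomorphism_restrict_open[OF inv(5) V(2) inv(1) V(1), folded U_def]
  have inj: "inj_on \<Phi> U2" using homeomorphism_apply1[OF inv(5)] by (rule inj_on_inverseI)
  have "U \<subseteq> U3"
  proof
    fix z assume "z \<in> U"
    then obtain y where "y \<in> U3" "\<Phi> z = \<Phi> y" "z \<in> U2" by (auto simp: U_def V_def)
    then show "z \<in> U3" using inj U3(3) by (metis inj_onD subsetD)
  qed
  have "\<Phi> p \<in> O'" using O'(2) p(1) U3(2) by blast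
  have "p \<in> U" using inv(3) U3(2) \<open>\<Phi> p \<in> O'\<close> by (auto simp: U_def V_def)
  have "\<Phi> ` (M \<inter> U) = V \<inter> T"
  proof (intro equalityI subsetI)
    fix w assume "w \<in> \<Phi> ` (M \<inter> U)"
    then show "w \<in> V \<inter> T" using \<Phi>T inv(2) by (auto simp: U_def)
  next
    fix w assume w: "w \<in> V \<inter> T"
    then obtain z where "z \<in> M" "z \<in> U3" "w = \<Phi> z" using O'(2) by (auto simp: V_def)
    then show "w \<in> \<Phi> ` (M \<inter> U)" using w U3(3) by (auto simp: U_def)
  qed
  \<comment> \<open>Both \<open>\<Psi> w\<close> and its conjugate are sent to the real point
    \<open>w\<close>, so injectivity makes them equal.\<close>
  moreover have "cnj_vec (\<Psi> w) = \<Psi> w" if "w \<in> V" "cnj_vec w = w" for w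
  proof -
    have "\<Psi> w \<in> U" "\<Phi> (\<Psi> w) = w" using hom(1) that(1) by (auto simp: homeomorphism_def)
    then have "\<Phi> (cnj_vec (\<Psi> w)) = \<Phi> (\<Psi> w)" "cnj_vec (\<Psi> w) \<in> U2" "\<Psi> w \<in> U2"
      using cnj\<Phi>[of "\<Psi> w"] that(2) U3(3,4) \<open>U \<subseteq> U3\<close> by auto
    then show ?thesis using inj by (simp add: inj_on_eq_iff)
  qed
  ultimately show ?thesis
    using that[of T U V \<Phi> \<Psi>] T(2,3) dimW cnjT hom \<open>p \<in> U\<close> V \<Phi>p d\<Phi>p cnj\<Phi>
      holomorphic_map_on_subset[OF hol, of U] holomorphic_map_on_subset[OF inv(6) V(2)]
      \<open>U \<subseteq> U3\<close> U3(3) inv(2) by (metis image_subsetI order_trans)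
qed

section \<open>Real forms of conjugation invariant subspaces\<close>

lemma cvec_re_im_vec:
  "cvec (re_vec z) = (1 / 2) *s (z + cnj_vec z)" "cvec (im_vec z) = (1 / (2 * \<i>)) *s (z - cnj_vec z)"
  by (simp_all add: cvec_defs vec_eq_iff complex_eq_iff)

text \<open>The real and imaginary parts of \<open>z\<close> are complex combinations of
  \<open>z\<close> and its conjugate; thus \<open>T\<close> is the complexification of its real
  points.\<close>

lemma mem_cnj_invariant_subspace_iff:
  assumes "vec.subspace T" "cnj_vec ` T \<subseteq> T"
  shows "z \<in> T \<longleftrightarrow> cvec (re_vec z) \<in> T \<and> cvec (im_vec z) \<in> T"
proof
  assume "z \<in> T"
  then have "cnj_vec z \<in> T" using assms(2) by blast
  with \<open>z \<in> T\<close> show "cvec (re_vec z) \<in> T \<and> cvec (im_vec z) \<in> T"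
    unfolding cvec_re_im_vec
    by (intro conjI vec.subspace_scale vec.subspace_add vec.subspace_diff assms(1))
next
  assume "cvec (re_vec z) \<in> T \<and> cvec (im_vec z) \<in> T"
  then have "cvec (re_vec z) + \<i> *s cvec (im_vec z) \<in> T"
    by (intro vec.subspace_scale vec.subspace_add assms(1)) auto
  then show "z \<in> T" by (simp only: vec_re_im_eq)
qed

lemma subspace_cvec_vimage:
  fixes T :: "(complex ^ 'n::finite) set"
  shows "subspace T \<Longrightarrow> subspace (cvec -` T)"
  using bounded_linear_vec_re_im(1) bounded_linear.linear linear_subspace_vimage by blast

text \<open>A real basis of the real points is a complex basis of \<open>T\<close>: it spans because
  \<open>T\<close> contains real and imaginary parts, and a complex relation splits into two real
  ones.\<close>

lemma dim_real_form:
  fixes T :: "(complex ^ 'n::finite) set"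
  assumes "vec.subspace T" "cnj_vec ` T \<subseteq> T"
  shows "dim (cvec -` T) = vec.dim T"
proof -
  obtain B where B: "B \<subseteq> cvec -` T" "independent B" "cvec -` T \<subseteq> span B" "card B = dim (cvec -` T)"
    by (rule basis_exists)
  have finB: "finite B" using B(2) by (rule independent_imp_finite)
  have inj: "inj_on cvec B" by (rule inj_onI) simp
  have "T \<subseteq> vec.span (cvec ` B)"
  proof
    fix z assume "z \<in> T"
    have span: "cvec a \<in> vec.span (cvec ` B)" if "a \<in> span B" for a
    proof -
      have "subspace (cvec -` vec.span (cvec ` B))"
        by (intro subspace_cvec_vimage vec_subspace_imp_subspace vec.subspace_span)
      moreover have "B \<subseteq> cvec -` vec.span (cvec ` B)" by (auto intro: vec.span_base)
      ultimately show ?thesis using that span_minimal by blast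
    qed
    have "cvec (re_vec z) \<in> T" "cvec (im_vec z) \<in> T"
      using \<open>z \<in> T\<close> mem_cnj_invariant_subspace_iff[OF assms] by blast+
    then have "cvec (re_vec z) + \<i> *s cvec (im_vec z) \<in> vec.span (cvec ` B)"
      using span B(3) by (intro vec.span_add vec.span_scale) auto
    then show "z \<in> vec.span (cvec ` B)" by (simp only: vec_re_im_eq)
  qed
  moreover have "vec.independent (cvec ` B)"
  proof
    assume "vec.dependent (cvec ` B)"
    then obtain u where u: "\<exists>v\<in>cvec ` B. u v \<noteq> 0" "(\<Sum>v\<in>cvec ` B. u v *s v) = 0"
      using finB by (auto simp: vec.dependent_finite)
    then have 0: "(\<Sum>b\<in>B. u (cvec b) *s cvec b) = 0" by (simp add: sum.reindex[OF inj] o_def)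
    have "(\<Sum>b\<in>B. Re (u (cvec b)) *\<^sub>R b) = re_vec (\<Sum>b\<in>B. u (cvec b) *s cvec b)"
      by (simp add: cvec_defs vec_eq_iff)
    then have re: "\<forall>b\<in>B. Re (u (cvec b)) = 0"
      using B(2) finB unfolding 0 by (auto simp: dependent_finite)
    have "(\<Sum>b\<in>B. Im (u (cvec b)) *\<^sub>R b) = im_vec (\<Sum>b\<in>B. u (cvec b) *s cvec b)"
      by (simp add: cvec_defs vec_eq_iff)
    then have im: "\<forall>b\<in>B. Im (u (cvec b)) = 0"
      using B(2) finB unfolding 0 by (auto simp: dependent_finite)
    from re im u(1) show False by (auto simp: complex_eq_iff)
  qed
  moreover have "card (cvec ` B) = dim (cvec -` T)" using card_image[OF inj] B(4) by simp
  ultimately show ?thesis using B(1) vec.dim_unique[of "cvec ` B" T] by (metis image_subset_iff_subset_vimage)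
qed

text \<open>In a chart that preserves realness, the real points of \<open>M\<close> correspond to
  those of \<open>T\<close>. The derivative of the chart at the base point is the identity, so the
  tangent spaces are \<open>T\<close> and its real points. The three claims share this chart and are
  proved together.\<close>

lemma real_points_of_submanifold:
  fixes M :: "(complex ^ 'n::finite) set"
  assumes M: "complex_submanifold d M" and cnjM: "cnj_vec ` M \<subseteq> M"
  shows "smooth_submanifold d (cvec -` M)"
    and "p \<in> cvec -` M \<Longrightarrow> subspace (tangent_space (cvec -` M) p)"
    and "p \<in> cvec -` M \<Longrightarrow> tangent_space M (cvec p) =
       {z. re_vec z \<in> tangent_space (cvec -` M) p \<and> im_vec z \<in> tangent_space (cvec -` M) p}"
proof -
  have "(\<exists>U V \<phi> \<psi> W. open U \<and> p \<in> U \<and> open V \<and> homeomorphism U V \<phi> \<psi> \<and> smooth_on U \<phi> \<and> smooth_on V \<psi> \<and>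
        subspace (W :: (real ^ 'n) set) \<and> dim W = d \<and> \<phi> ` (cvec -` M \<inter> U) = V \<inter> W) \<and>
     subspace (tangent_space (cvec -` M) p) \<and> tangent_space M (cvec p) =
       {z. re_vec z \<in> tangent_space (cvec -` M) p \<and> im_vec z \<in> tangent_space (cvec -` M) p}"
    if p: "p \<in> cvec -` M" for p
  proof -
    have pM: "cvec p \<in> M" using p by simp
    obtain T U V \<Phi> \<Psi> where T: "vec.subspace T" "vec.dim T = d" "cnj_vec ` T \<subseteq> T"
      and opU: "open U" and pU: "cvec p \<in> U" and opV: "open V" and hom: "homeomorphism U V \<Phi> \<Psi>"
      and hol: "holomorphic_map_on U \<Phi>" "holomorphic_map_on V \<Psi>" and im: "\<Phi> ` (M \<inter> U) = V \<inter> T"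
      and \<Phi>p: "\<Phi> (cvec p) = 0" "(\<Phi> has_derivative (\<lambda>v. v)) (at (cvec p))"
      and real: "\<And>z. z \<in> U \<Longrightarrow> cnj_vec z = z \<Longrightarrow> cnj_vec (\<Phi> z) = \<Phi> z"
        "\<And>w. w \<in> V \<Longrightarrow> cnj_vec w = w \<Longrightarrow> cnj_vec (\<Psi> w) = \<Psi> w"
      by (rule cnj_invariant_submanifold_chart[OF M cnjM pM]) auto
    note chart = opU opV hom hol pU T(1) im pM
    have realU: "cvec (re_vec (\<Phi> (cvec x))) = \<Phi> (cvec x)" if "cvec x \<in> U" for x
      using real(1)[OF that] by (simp add: cnj_vec_fixed_iff)
    have realV: "cvec (re_vec (\<Psi> (cvec x))) = \<Psi> (cvec x)" if "cvec x \<in> V" for x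
      using real(2)[OF that] by (simp add: cnj_vec_fixed_iff)
    have mem: "\<And>z. z \<in> U \<Longrightarrow> \<Phi> z \<in> V" "\<And>w. w \<in> V \<Longrightarrow> \<Psi> w \<in> U"
      "\<And>z. z \<in> U \<Longrightarrow> \<Psi> (\<Phi> z) = z" "\<And>w. w \<in> V \<Longrightarrow> \<Phi> (\<Psi> w) = w"
      using hom by (auto simp: homeomorphism_def)
    have op: "open (cvec -` S)" if "open S" for S :: "(complex ^ 'n) set"
      using that continuous_on_vec_re_im(1)[of UNIV]
      by (intro continuous_open_vimage) (auto simp: continuous_on_eq_continuous_at)
    let ?\<phi> = "\<lambda>x. re_vec (\<Phi> (0 + cvec x))" and ?\<psi> = "\<lambda>x. re_vec (\<Psi> (0 + cvec x))"
    let ?T = "cvec -` T"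
    have sm: "smooth_on (cvec -` U) ?\<phi>" "smooth_on (cvec -` V) ?\<psi>"
      by (rule smooth_on_holomorphic_between_affine[OF opU hol(1) bounded_linear_vec_re_im(1,2) op[OF opU]], simp)
         (rule smooth_on_holomorphic_between_affine[OF opV hol(2) bounded_linear_vec_re_im(1,2) op[OF opV]], simp)
    have hom': "homeomorphism (cvec -` U) (cvec -` V) ?\<phi> ?\<psi>"
    proof (rule homeomorphismI)
      have "Ck_on 0 (cvec -` U) ?\<phi>" "Ck_on 0 (cvec -` V) ?\<psi>" using sm unfolding smooth_on_def by blast+
      then show "continuous_on (cvec -` U) ?\<phi>" "continuous_on (cvec -` V) ?\<psi>" by simp_all
    qed (auto simp: realU realV mem)
    have im': "?\<phi> ` (cvec -` M \<inter> cvec -` U) = cvec -` V \<inter> ?T"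
    proof (intro equalityI subsetI)
      fix w assume "w \<in> ?\<phi> ` (cvec -` M \<inter> cvec -` U)"
      then obtain x where "cvec x \<in> M \<inter> U" "w = ?\<phi> x" by auto
      then have "cvec w = \<Phi> (cvec x)" using realU by simp
      then show "w \<in> cvec -` V \<inter> ?T" using im \<open>cvec x \<in> M \<inter> U\<close> by auto
    next
      fix w assume w: "w \<in> cvec -` V \<inter> ?T"
      then have "cvec w \<in> \<Phi> ` (M \<inter> U)" using im by simp
      then obtain z where z: "z \<in> M" "z \<in> U" "\<Phi> z = cvec w" by auto
      then have "z = \<Psi> (cvec w)" using mem(3) by metis
      then have "z = cvec (?\<psi> w)" using realV w by simp
      then have "w = ?\<phi> (?\<psi> w)" "?\<psi> w \<in> cvec -` M \<inter> cvec -` U" using z by auto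
      then show "w \<in> ?\<phi> ` (cvec -` M \<inter> cvec -` U)" by blast
    qed
    have D: "frechet_derivative \<Phi> (at (cvec p)) = (\<lambda>v. v)"
      using frechet_derivative_at[OF \<Phi>p(2)] by simp
    have mT: "model_space \<Phi> (cvec p) T = T" by (simp add: model_space_def D)
    have tR: "tangent_space (cvec -` M) p = ?T"
    proof (intro equalityI subsetI)
      fix a assume "a \<in> tangent_space (cvec -` M) p"
      then obtain \<gamma> e where \<gamma>: "e > 0" "\<gamma> ` {-e<..<e} \<subseteq> cvec -` M" "\<gamma> (0::real) = p" "(\<gamma> has_vector_derivative a) (at 0)"
        unfolding tangent_space_def by blast
      have "eventually (\<lambda>t. t \<in> {-e<..<e}) (at (0::real))"
        using \<gamma>(1) by (intro eventually_at_in_open') auto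
      then have "eventually (\<lambda>t. cvec (\<gamma> t) \<in> M) (at 0)"
        by eventually_elim (use \<gamma>(2) in blast)
      moreover have "((\<lambda>t. cvec (\<gamma> t)) has_vector_derivative cvec a) (at 0)"
        using \<gamma>(4) by (rule bounded_linear.has_vector_derivative[OF bounded_linear_vec_re_im(1)])
      ultimately show "a \<in> ?T"
        using curve_derivative_in_model_space[OF chart(1-4,7,8), of "\<lambda>t. cvec (\<gamma> t)" "cvec a"]
          \<gamma>(3) pM pU mT by simp
    next
      fix a assume a: "a \<in> ?T"
      \<comment> \<open>A straight line in a real direction, pulled back by the chart;
        \<open>\<Psi>\<close> preserves realness, so the curve stays among the real points.\<close>
      define \<gamma> where "\<gamma> t = \<Psi> (\<Phi> (cvec p) + t *\<^sub>R frechet_derivative \<Phi> (at (cvec p)) (cvec a))" for t :: real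
      have "cvec a \<in> model_space \<Phi> (cvec p) T" using a mT by simp
      note c = curve_through_model_space[OF chart this bounded_linear_vec_re_im(2), folded \<gamma>_def]
      obtain e where e: "e > 0" "smooth_on {-e<..<e} (\<lambda>t. re_vec (\<gamma> t))" "\<gamma> ` {-e<..<e} \<subseteq> M"
        "\<forall>t\<in>{-e<..<e}. \<Phi> (cvec p) + t *\<^sub>R frechet_derivative \<Phi> (at (cvec p)) (cvec a) \<in> V"
        using c(1) by blast
      have "cvec (re_vec (\<gamma> t)) = \<gamma> t" if "t \<in> {-e<..<e}" for t
      proof -
        have "t *\<^sub>R cvec a = cvec (t *\<^sub>R a)" by (simp add: cvec_defs vec_eq_iff scaleR_conv_of_real[where 'a = complex])
        then show ?thesis using bspec[OF e(4) that] realV[of "t *\<^sub>R a"] by (simp add: \<gamma>_def \<Phi>p(1) D)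
      qed
      then have "(\<lambda>t. re_vec (\<gamma> t)) ` {-e<..<e} \<subseteq> cvec -` M"
        using e(3) by auto
      moreover have "((\<lambda>t. re_vec (\<gamma> t)) has_vector_derivative a) (at 0)"
        using bounded_linear.has_vector_derivative[OF bounded_linear_vec_re_im(2) c(3)] by simp
      ultimately show "a \<in> tangent_space (cvec -` M) p"
        unfolding tangent_space_def using e(1,2) c(2) 
        by (intro CollectI exI[of _ "\<lambda>t. re_vec (\<gamma> t)"] exI[of _ e]) auto
    qed
    have tC: "tangent_space M (cvec p) = T"
      using tangent_space_eq_model_space[OF chart] mT by simp
    have sub: "subspace ?T" using vec_subspace_imp_subspace[OF T(1)] by (rule subspace_cvec_vimage)
    have "T = {z. re_vec z \<in> ?T \<and> im_vec z \<in> ?T}"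
      unfolding vimage_eq using mem_cnj_invariant_subspace_iff[OF T(1,3)] by blast
    moreover have "dim ?T = d" using dim_real_form[OF T(1,3)] T(2) by simp
    ultimately show ?thesis
      unfolding tR tC using sub op[OF opU] op[OF opV] pU hom' sm im'
      by (intro conjI exI[of _ "cvec -` U"] exI[of _ "cvec -` V"] exI[of _ ?\<phi>] exI[of _ ?\<psi>] exI[of _ ?T]) simp_all
  qed
  then show "smooth_submanifold d (cvec -` M)"
    "p \<in> cvec -` M \<Longrightarrow> subspace (tangent_space (cvec -` M) p)"
    "p \<in> cvec -` M \<Longrightarrow> tangent_space M (cvec p) =
       {z. re_vec z \<in> tangent_space (cvec -` M) p \<and> im_vec z \<in> tangent_space (cvec -` M) p}"
    unfolding smooth_submanifold_def by blast+
qed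

section \<open>Condition (B) for the real points\<close>

text \<open>A curve in \<open>S\<close> through \<open>p\<close> has a connected image and cannot
  leave the component.\<close>

lemma tangent_space_component:
  assumes "C \<in> components S" "p \<in> C"
  shows "tangent_space C p = tangent_space S p"
proof (intro equalityI subsetI)
  fix v assume "v \<in> tangent_space C p"
  then show "v \<in> tangent_space S p"
    unfolding tangent_space_def using in_components_subset[OF assms(1)] by blast
next
  fix v assume "v \<in> tangent_space S p"
  then obtain \<gamma> e where \<gamma>: "e > 0" "smooth_on {-e<..<e} \<gamma>" "\<gamma> ` {-e<..<e} \<subseteq> S"
    "\<gamma> (0::real) = p" "(\<gamma> has_vector_derivative v) (at 0)"
    unfolding tangent_space_def by blast
  have "Ck_on 0 {-e<..<e} \<gamma>" using \<gamma>(2) unfolding smooth_on_def by blast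
  then have "connected (\<gamma> ` {-e<..<e})"
    by (intro connected_continuous_image) auto
  moreover have "p \<in> \<gamma> ` {-e<..<e}" using \<gamma>(1,4) by force
  ultimately have "\<gamma> ` {-e<..<e} \<subseteq> C"
    using components_maximal[OF assms(1) _ \<gamma>(3)] assms(2) by blast
  then show "v \<in> tangent_space C p" unfolding tangent_space_def using \<gamma> by blast
qed

text \<open>The chart is cut down to a ball, whose slice by \<open>W\<close> is convex; hence the
  corresponding part of \<open>S\<close> is connected and lies in one component.\<close>

lemma smooth_submanifold_component:
  fixes S :: "'a::euclidean_space set"
  assumes "smooth_submanifold d S" "C \<in> components S"
  shows "smooth_submanifold d C"
  unfolding smooth_submanifold_def
proof
  fix p assume p: "p \<in> C"
  then have "p \<in> S" using assms(2) in_components_subset by blast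
  then obtain U V \<phi> \<psi> and W :: "'a set" where chart: "open U" "p \<in> U" "open V" "homeomorphism U V \<phi> \<psi>"
    "smooth_on U \<phi>" "smooth_on V \<psi>" "subspace W" "dim W = d" "\<phi> ` (S \<inter> U) = V \<inter> W"
    using assms(1) unfolding smooth_submanifold_def by meson
  have "\<phi> p \<in> V" using chart(2,4) by (auto simp: homeomorphism_def)
  then obtain r where r: "r > 0" "ball (\<phi> p) r \<subseteq> V" using chart(3) openE by blast
  let ?V = "ball (\<phi> p) r"
  let ?U = "U \<inter> \<phi> -` ?V"
  note hom = homeomorphism_restrict_open[OF chart(4) r(2) chart(1) open_ball]
  have "\<phi> ` (S \<inter> ?U) = \<phi> ` (S \<inter> U) \<inter> ?V" by blast
  then have im: "\<phi> ` (S \<inter> ?U) = ?V \<inter> W"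
    unfolding chart(9) using r(2) by blast
  have "S \<inter> ?U = \<psi> ` (\<phi> ` (S \<inter> ?U))"
    unfolding image_image using chart(4) by (auto simp: homeomorphism_def image_iff)
  then have eq: "S \<inter> ?U = \<psi> ` (?V \<inter> W)" by (simp only: im)
  have "connected (?V \<inter> W)"
    by (intro convex_connected convex_Int convex_ball subspace_imp_convex chart(7))
  moreover have "continuous_on (?V \<inter> W) \<psi>"
    using chart(4) r(2) by (meson continuous_on_subset homeomorphism_cont2 inf.coboundedI1)
  ultimately have "connected (S \<inter> ?U)" unfolding eq by (intro connected_continuous_image)
  moreover have "p \<in> S \<inter> ?U" using \<open>p \<in> S\<close> chart(2) r(1) by simp
  ultimately have "S \<inter> ?U \<subseteq> C"
    using components_maximal[OF assms(2), of "S \<inter> ?U"] p by blast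
  then have "C \<inter> ?U = S \<inter> ?U" using in_components_subset[OF assms(2)] by blast
  then have "\<phi> ` (C \<inter> ?U) = ?V \<inter> W" using im by (simp only:)
  moreover have "smooth_on ?U \<phi>" "smooth_on ?V \<psi>"
    using chart(5,6) r(2) by (auto intro: smooth_on_subset)
  moreover have "p \<in> ?U" using \<open>p \<in> S \<inter> ?U\<close> by blast
  ultimately show "\<exists>U V \<phi> \<psi> W. open U \<and> p \<in> U \<and> open V \<and> homeomorphism U V \<phi> \<psi> \<and> smooth_on U \<phi> \<and>
      smooth_on V \<psi> \<and> subspace (W :: 'a set) \<and> dim W = d \<and> \<phi> ` (C \<inter> U) = V \<inter> W"
    using hom chart(7,8)
    by (intro exI[of _ ?U] exI[of _ ?V] exI[of _ \<phi>] exI[of _ \<psi>] exI[of _ W] conjI) simp_all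
qed

section \<open>Projectors and complexification\<close>

lemma norm_re_im_vec: "(norm (z :: complex ^ 'n::finite))\<^sup>2 = (norm (re_vec z))\<^sup>2 + (norm (im_vec z))\<^sup>2"
  by (simp add: norm_vec_def L2_set_def sum_nonneg cmod_power2 sum.distrib re_vec_def im_vec_def)

lemma dist_re_im_vec:
  "(dist z (w :: complex ^ 'n::finite))\<^sup>2 = (dist (re_vec z) (re_vec w))\<^sup>2 + (dist (im_vec z) (im_vec w))\<^sup>2"
proof -
  have "re_vec (z - w) = re_vec z - re_vec w" "im_vec (z - w) = im_vec z - im_vec w"
    by (simp_all add: cvec_defs vec_eq_iff)
  then show ?thesis by (simp add: dist_norm norm_re_im_vec)
qed

text \<open>Two factors are allowed because tangent spaces and secants behave differently:
  \<open>A = B\<close> gives a complexified tangent space, \<open>B = {0}\<close> a real secant line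
  placed in complex space.\<close>

definition re_im_product :: "(real ^ 'n) set \<Rightarrow> (real ^ 'n) set \<Rightarrow> (complex ^ 'n) set" where
  "re_im_product A B = {z. re_vec z \<in> A \<and> im_vec z \<in> B}"

lemma subspace_re_im_product:
  fixes A B :: "(real ^ 'n::finite) set"
  assumes "subspace A" "subspace B"
  shows "subspace (re_im_product A B)"
proof -
  have "re_im_product A B = re_vec -` A \<inter> im_vec -` B" by (auto simp: re_im_product_def)
  moreover have "subspace (re_vec -` A)" "subspace (im_vec -` B)"
    using assms bounded_linear_vec_re_im(2,3) bounded_linear.linear linear_subspace_vimage by blast+
  ultimately show ?thesis by (simp add: subspace_inter)
qed

text \<open>Squared distances split into a real and an imaginary contribution, which can be
  minimized separately.\<close>

lemma closest_point_re_im_product: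
  fixes A B :: "(real ^ 'n::finite) set"
  assumes "subspace A" "subspace B"
  shows "closest_point (re_im_product A B) z =
    cvec (closest_point A (re_vec z)) + \<i> *s cvec (closest_point B (im_vec z))"
proof -
  let ?w = "cvec (closest_point A (re_vec z)) + \<i> *s cvec (closest_point B (im_vec z))"
  have w: "re_vec ?w = closest_point A (re_vec z)" "im_vec ?w = closest_point B (im_vec z)" by simp_all
  have ne: "A \<noteq> {}" "B \<noteq> {}" using assms subspace_0 by blast+
  note cl = closed_subspace[OF assms(1)] closed_subspace[OF assms(2)]
  have "?w \<in> re_im_product A B"
    unfolding re_im_product_def using closest_point_in_set ne cl w by (metis (mono_tags) mem_Collect_eq)
  moreover have "dist z ?w \<le> dist z x" if "x \<in> re_im_product A B" for x
  proof (rule power2_le_imp_le)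
    have "dist (re_vec z) (re_vec ?w) \<le> dist (re_vec z) (re_vec x)"
      "dist (im_vec z) (im_vec ?w) \<le> dist (im_vec z) (im_vec x)"
      unfolding w using that closest_point_le cl by (auto simp: re_im_product_def)
    then show "(dist z ?w)\<^sup>2 \<le> (dist z x)\<^sup>2"
      unfolding dist_re_im_vec by (intro add_mono power_mono) auto
  qed simp
  ultimately show ?thesis
    using subspace_re_im_product[OF assms]
    by (intro closest_point_unique[symmetric] ballI subspace_imp_convex closed_subspace)
qed

lemma subspace_tendsto_re_im_product:
  fixes A B :: "nat \<Rightarrow> (real ^ 'n::finite) set"
  assumes "\<And>k. subspace (A k)" "\<And>k. subspace (B k)" "subspace_tendsto A S" "subspace_tendsto B T"
  shows "subspace_tendsto (\<lambda>k. re_im_product (A k) (B k)) (re_im_product S T)"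
proof -
  have ST: "subspace S" "subspace T" using assms(3,4) by (auto simp: subspace_tendsto_def)
  have "bounded_linear (\<lambda>x :: real ^ 'n. \<i> *s cvec x)"
    unfolding linear_conv_bounded_linear[symmetric]
    by (rule linearI) (simp_all add: cvec_defs vec_eq_iff scaleR_conv_of_real[where 'a = complex] distrib_left)
  note lim = bounded_linear.tendsto[OF bounded_linear_vec_re_im(1)] bounded_linear.tendsto[OF this]
  have "(\<lambda>k. cvec (closest_point (A k) (re_vec z)) + \<i> *s cvec (closest_point (B k) (im_vec z)))
      \<longlonglongrightarrow> cvec (closest_point S (re_vec z)) + \<i> *s cvec (closest_point T (im_vec z))" for z
    by (rule tendsto_add; rule lim) (use assms(3,4) in \<open>simp_all add: subspace_tendsto_def\<close>)
  then show ?thesis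
    unfolding subspace_tendsto_def closest_point_re_im_product[OF assms(1,2)] closest_point_re_im_product[OF ST]
    using subspace_re_im_product[OF ST] by blast
qed

text \<open>\<open>span\<close> is taken over the reals, so the secant line of real points acquires
  no imaginary part.\<close>

lemma span_cvec: "span {cvec x} = re_im_product (span {x}) {0 :: real ^ 'n::finite}"
proof (intro equalityI subsetI)
  fix z assume "z \<in> span {cvec x}"
  then obtain r where "z = r *\<^sub>R cvec x" by (auto simp: span_singleton)
  then have "re_vec z = r *\<^sub>R x" "im_vec z = 0" by (simp_all add: cvec_defs vec_eq_iff)
  then show "z \<in> re_im_product (span {x}) {0}" by (auto simp: re_im_product_def span_singleton)
next
  fix z assume "z \<in> re_im_product (span {x}) {0}"
  then obtain r where "re_vec z = r *\<^sub>R x" "im_vec z = 0"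
    by (auto simp: re_im_product_def span_singleton)
  then have "z = r *\<^sub>R cvec x" by (simp add: cvec_defs vec_eq_iff complex_eq_iff)
  then show "z \<in> span {cvec x}" by (auto simp: span_singleton)
qed

lemma component_of_real_points:
  fixes M :: "(complex ^ 'n::finite) set"
  assumes "C \<in> components (cvec -` M)"
  obtains C' where "C' \<in> components M" "cvec ` C \<subseteq> C'"
proof -
  have "connected (cvec ` C)"
    using in_components_connected[OF assms] continuous_on_vec_re_im(1) by (rule connected_continuous_image[rotated])
  moreover have "cvec ` C \<subseteq> M" "cvec ` C \<noteq> {}"
    using in_components_subset[OF assms] in_components_nonempty[OF assms] by auto
  ultimately show ?thesis
    using that exists_component_superset by (metis subset_empty)
qed

text \<open>The sequences are viewed in complex space. There the tangent spaces tend to the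
  complexification of \<open>T\<close>, and the secants to \<open>l\<close> with zero imaginary
  part. The inclusion given by Condition (B), restricted to real vectors, is
  \<open>l \<subseteq> T\<close>.\<close>

lemma condition_B_real_points:
  fixes M N :: "(complex ^ 'n::finite) set"
  assumes M: "complex_submanifold d M" "cnj_vec ` M \<subseteq> M"
    and B: "\<And>C' D'. C' \<in> components M \<Longrightarrow> D' \<in> components N \<Longrightarrow> condition_B C' D'"
    and C: "C \<in> components (cvec -` M)" and D: "D \<in> components (cvec -` N)"
  shows "condition_B C D"
  unfolding condition_B_def
proof (intro ballI allI impI)
  obtain C' where C': "C' \<in> components M" "cvec ` C \<subseteq> C'" using C by (rule component_of_real_points)
  obtain D' where D': "D' \<in> components N" "cvec ` D \<subseteq> D'" using D by (rule component_of_real_points)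
  fix y p q T l
  assume y: "y \<in> D" and "(\<forall>k. p k \<in> C) \<and> (\<forall>k. q k \<in> D) \<and> (\<forall>k. p k \<noteq> q k) \<and> p \<longlonglongrightarrow> y \<and> q \<longlonglongrightarrow> y \<and>
      subspace_tendsto (\<lambda>k. tangent_space C (p k)) T \<and> subspace_tendsto (\<lambda>k. span {p k - q k}) l"
  then have pq: "\<And>k. p k \<in> C" "\<And>k. q k \<in> D" "\<And>k. p k \<noteq> q k" "p \<longlonglongrightarrow> y" "q \<longlonglongrightarrow> y"
    "subspace_tendsto (\<lambda>k. tangent_space C (p k)) T" "subspace_tendsto (\<lambda>k. span {p k - q k}) l"
    by blast+
  have tan: "subspace (tangent_space C (p k))"
    "tangent_space C' (cvec (p k)) = re_im_product (tangent_space C (p k)) (tangent_space C (p k))" for k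
  proof -
    have mem: "p k \<in> cvec -` M" "cvec (p k) \<in> C'"
      using pq(1) in_components_subset[OF C] C'(2) by blast+
    \<comment> \<open>Tangent spaces are moved from the components to the whole sets, because
      conjugation invariance is known for \<open>M\<close> and not for \<open>C'\<close>.\<close>
    note eq = tangent_space_component[OF C pq(1)[of k]] tangent_space_component[OF C'(1) mem(2)]
    show "subspace (tangent_space C (p k))"
      unfolding eq by (rule real_points_of_submanifold(2)[OF M mem(1)])
    show "tangent_space C' (cvec (p k)) = re_im_product (tangent_space C (p k)) (tangent_space C (p k))"
      unfolding eq re_im_product_def by (rule real_points_of_submanifold(3)[OF M mem(1)])
  qed
  have "subspace_tendsto (\<lambda>k. tangent_space C' (cvec (p k))) (re_im_product T T)"
    unfolding tan(2) by (rule subspace_tendsto_re_im_product[OF tan(1) tan(1) pq(6) pq(6)])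
  moreover have "subspace_tendsto (\<lambda>k. span {cvec (p k) - cvec (q k)}) (re_im_product l {0})"
  proof -
    have "subspace_tendsto (\<lambda>k. {0 :: real ^ 'n}) {0}"
      by (simp add: subspace_tendsto_def)
    then have "subspace_tendsto (\<lambda>k. re_im_product (span {p k - q k}) {0}) (re_im_product l {0})"
      by (intro subspace_tendsto_re_im_product pq(7)) simp_all
    then show ?thesis unfolding span_cvec[symmetric] by simp
  qed
  moreover have "(\<lambda>k. cvec (p k)) \<longlonglongrightarrow> cvec y" "(\<lambda>k. cvec (q k)) \<longlonglongrightarrow> cvec y"
    using pq(4,5) bounded_linear.tendsto[OF bounded_linear_vec_re_im(1)] by blast+
  moreover have "cvec (p k) \<in> C'" "cvec (q k) \<in> D'" "cvec (p k) \<noteq> cvec (q k)" for k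
    using pq(1,2,3) C'(2) D'(2) by auto
  moreover have "cvec y \<in> D'" using y D'(2) by blast
  ultimately have sub: "re_im_product l {0} \<subseteq> re_im_product T T"
    using B[OF C'(1) D'(1), unfolded condition_B_def, rule_format, of "cvec y" "\<lambda>k. cvec (p k)" "\<lambda>k. cvec (q k)"]
    by simp
  show "l \<subseteq> T"
  proof
    fix x assume "x \<in> l"
    then have "cvec x \<in> re_im_product l {0}" by (simp add: re_im_product_def)
    then have "cvec x \<in> re_im_product T T" using sub by blast
    then show "x \<in> T" by (simp add: re_im_product_def)
  qed
qed

section \<open>Flags\<close>

lemma mpoly_eval_complexify:
  fixes g :: "('n::finite, real) mpoly"
  shows "mpoly_eval (complexify g) z =
    (\<Sum>\<alpha>\<in>Poly_Mapping.keys g. of_real (Poly_Mapping.lookup g \<alpha>) * (\<Prod>i\<in>UNIV. (z $ i) ^ Poly_Mapping.lookup \<alpha> i))"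
proof -
  have lookup: "Poly_Mapping.lookup (complexify g) \<alpha> = of_real (Poly_Mapping.lookup g \<alpha>)" for \<alpha>
    by (simp add: complexify_def Poly_Mapping.map.rep_eq when_def)
  have "Poly_Mapping.keys (complexify g) = Poly_Mapping.keys g"
    by (auto simp: in_keys_iff lookup)
  then show ?thesis by (simp add: mpoly_eval_def lookup)
qed

lemma mpoly_eval_complexify_cvec: "mpoly_eval (complexify g) (cvec x) = of_real (mpoly_eval g x)"
  unfolding mpoly_eval_complexify by (simp add: mpoly_eval_def cvec_def)

lemma mpoly_eval_complexify_cnj: "mpoly_eval (complexify g) (cnj_vec z) = cnj (mpoly_eval (complexify g) z)"
  unfolding mpoly_eval_complexify by (simp add: cnj_vec_def)

lemma cvec_vimage_zero_set: "cvec -` zero_set (complexify ` F) = zero_set F"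
  by (auto simp: zero_set_def mpoly_eval_complexify_cvec)

lemma cnj_vec_zero_set_iff: "cnj_vec z \<in> zero_set (complexify ` F) \<longleftrightarrow> z \<in> zero_set (complexify ` F)"
  by (auto simp: zero_set_def mpoly_eval_complexify_cnj)

section \<open>Differences and strata of a flag\<close>

lemma flag_diff_subset: "flag_diff X i \<subseteq> X i"
  by (auto simp: flag_diff_def split: nat.splits)

lemma flag_mono:
  assumes "\<And>i. i < m \<Longrightarrow> X i \<subseteq> X (Suc i)" "i \<le> j" "j \<le> m"
  shows "X i \<subseteq> X j"
  using assms(2,3) by (induction rule: dec_induct) (use assms(1) in \<open>auto dest: Suc_le_lessD\<close>)

lemma UN_flag_diff:
  assumes "\<And>i. i < m \<Longrightarrow> X i \<subseteq> X (Suc i)"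
  shows "(\<Union>i\<le>m. flag_diff X i) = X m"
  using assms
proof (induction m)
  case 0
  then show ?case by (simp add: flag_diff_def)
next
  case (Suc m)
  then have "(\<Union>i\<le>m. flag_diff X i) = X m" "X m \<subseteq> X (Suc m)" by auto
  then show ?case by (auto simp: atMost_Suc flag_diff_def)
qed

lemma flag_diff_disjoint:
  assumes "\<And>i. i < m \<Longrightarrow> X i \<subseteq> X (Suc i)" "i < j" "j \<le> m"
  shows "flag_diff X i \<inter> flag_diff X j = {}"
proof -
  obtain j' where j: "j = Suc j'" using assms(2) by (cases j) auto
  then have "X i \<subseteq> X j'" using assms by (intro flag_mono[of m X, OF assms(1)]) auto
  then show ?thesis using flag_diff_subset[of X i] by (auto simp: j flag_diff_def)
qed

lemma disjoint_flag_strata: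
  assumes "\<And>i. i < m \<Longrightarrow> X i \<subseteq> X (Suc i)"
  shows "disjoint (flag_strata m X)"
proof (rule disjointI)
  fix C D assume "C \<in> flag_strata m X" "D \<in> flag_strata m X" "C \<noteq> D"
  then obtain i j where ij: "i \<le> m" "j \<le> m" "C \<in> components (flag_diff X i)" "D \<in> components (flag_diff X j)"
    by (auto simp: flag_strata_def)
  show "C \<inter> D = {}"
  proof (cases "i = j")
    case True
    then show ?thesis using ij \<open>C \<noteq> D\<close> components_nonoverlap by blast
  next
    case False
    then have "flag_diff X i \<inter> flag_diff X j = {}"
      using flag_diff_disjoint[of m X, OF assms] ij by (metis Int_commute linorder_neqE_nat)
    then show ?thesis using ij(3,4) in_components_subset by blast
  qed
qed

lemma finite_flag_strata_zero_sets:
  fixes I :: "nat \<Rightarrow> ('n::finite, real) mpoly set"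
  assumes "\<And>i. i \<le> m \<Longrightarrow> is_ideal (I i)"
  shows "finite (flag_strata m (\<lambda>i. zero_set (I i)))"
proof -
  have "finite (components (flag_diff (\<lambda>i. zero_set (I i)) i))" if "i \<le> m" for i
  proof -
    obtain F where F: "real_polynomial_function F" "zero_set (I i) = {x. F x = 0}"
      by (rule zero_set_ideal_single_real_polynomial[OF assms[OF \<open>i \<le> m\<close>]])
    show ?thesis
    proof (cases i)
      case 0
      \<comment> \<open>The bottom difference is the whole zero set of \<open>I 0\<close>, obtained
        by removing the empty zero set of the constant 1.\<close>
      then show ?thesis
        using finite_components_zeros_diff[OF F(1) real_polynomial_function.intros(2)[of 1]] F(2)
        by (simp add: flag_diff_def)
    next
      case (Suc j)
      then have "j \<le> m" using that by simp
      obtain g where "real_polynomial_function g" "zero_set (I j) = {x. g x = 0}"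
        by (rule zero_set_ideal_single_real_polynomial[OF assms[OF \<open>j \<le> m\<close>]])
      then show ?thesis
        using finite_components_zeros_diff[OF F(1)] F(2) Suc by (simp add: flag_diff_def)
    qed
  qed
  then show ?thesis by (simp add: flag_strata_def)
qed

theorem theorem4p3:
  fixes I :: "nat \<Rightarrow> ('n::finite, real) mpoly set" and m :: nat
  assumes radical: "\<forall>i\<le>m. radical_ideal (I i)"
    and chain: "\<forall>i<m. I (Suc i) \<subseteq> I i"
    and complex_flag: "complex_whitney_flag m (\<lambda>i. zero_set (complexify ` I i))"
  shows "real_whitney_flag m (\<lambda>i. zero_set (I i))"
proof -
  define X where "X i = zero_set (I i)" for i
  define XC where "XC i = zero_set (complexify ` I i)" for i
  have X_mono: "X i \<subseteq> X (Suc i)" if "i < m" for i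
    using chain that by (auto simp: X_def zero_set_def)
  have real_diff: "flag_diff X i = cvec -` flag_diff XC i" for i
    by (auto simp: flag_diff_def X_def XC_def cvec_vimage_zero_set[symmetric] split: nat.splits)
  have cnj_diff: "cnj_vec ` flag_diff XC i \<subseteq> flag_diff XC i" for i
    by (auto simp: flag_diff_def XC_def cnj_vec_zero_set_iff split: nat.splits)
  \<comment> \<open>The empty set is vacuously a submanifold, which removes the case distinction on
    empty differences.\<close>
  have "complex_submanifold i {}" for i by (simp add: complex_submanifold_def)
  then have cmfd: "complex_submanifold i (flag_diff XC i)" if "i \<le> m" for i
    using complex_flag that unfolding complex_whitney_flag_def XC_def by metis
  have rmfd: "smooth_submanifold i (flag_diff X i)" if "i \<le> m" for i
    unfolding real_diff using cmfd[OF that] cnj_diff by (rule real_points_of_submanifold(1))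
  have "condition_B C D" if CD: "C \<in> flag_strata m X" "D \<in> flag_strata m X" for C D
  proof -
    obtain i j where ij: "i \<le> m" "j \<le> m" "C \<in> components (cvec -` flag_diff XC i)" "D \<in> components (cvec -` flag_diff XC j)"
      using CD by (auto simp: flag_strata_def real_diff)
    have "condition_B C' D'" if "C' \<in> components (flag_diff XC i)" "D' \<in> components (flag_diff XC j)" for C' D'
    proof -
      have "C' \<in> flag_strata m XC" "D' \<in> flag_strata m XC"
        using that ij(1,2) by (auto simp: flag_strata_def)
      then show ?thesis
        using complex_flag unfolding complex_whitney_flag_def whitney_stratification_def XC_def by blast
    qed
    then show ?thesis
      using condition_B_real_points[OF cmfd[OF ij(1)] cnj_diff _ ij(3,4)] by blast
  qed
  moreover have "finite (flag_strata m X)"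
    unfolding X_def using radical by (intro finite_flag_strata_zero_sets) (auto simp: radical_ideal_def)
  moreover have "S \<noteq> {} \<and> connected S \<and> (\<exists>d. smooth_submanifold d S)" if "S \<in> flag_strata m X" for S
    using that rmfd smooth_submanifold_component in_components_connected in_components_nonempty
    unfolding flag_strata_def by blast
  moreover have "\<Union>(flag_strata m X) = X m"
  proof -
    have "\<Union>(flag_strata m X) = (\<Union>i\<le>m. \<Union>(components (flag_diff X i)))"
      unfolding flag_strata_def by blast
    also have "\<dots> = X m"
      unfolding Union_components by (rule UN_flag_diff) (rule X_mono)
    finally show ?thesis .
  qed
  moreover have "disjoint (flag_strata m X)"
    using X_mono by (rule disjoint_flag_strata)
  \<comment> \<open>There are finitely many strata altogether, so the whole space serves as the
    neighbourhood in local finiteness.\<close>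
  ultimately have "whitney_stratification (X m) (flag_strata m X)"
    unfolding whitney_stratification_def by (auto intro!: exI[of _ UNIV])
  moreover have "subvariety_flag m X"
    using X_mono by (auto simp: subvariety_flag_def algebraic_set_def X_def)
  ultimately show ?thesis
    unfolding real_whitney_flag_def X_def[symmetric] using rmfd by blast
qed

end
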